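(* Let $n\ge2$, $\gamma\in\mathbb{C}\setminus\{0\}$, $s=u-v$. Define $$\hat B_{12}(\lambda)=\sum_{i=1}^n e_{ii}\otimes p_i,\qquad p_i=\left(\prod_{k\neq i}\frac{\lambda_{ik}}{\lambda_{ik}+\gamma}\right)e_{ii}+\sum_{j\neq i}\left(e_{jj}-\frac{\gamma}{\lambda_{ji}-\gamma}\left(\prod_{k\neq i,j}\frac{\lambda_{ik}}{\lambda_{jk}}\right)e_{ij}\right),\qquad \hat C_{12}=\hat B_{21},$$ $$\begin{aligned}\hat A_{12}(u-v;\lambda)=&\left(1+\frac{\gamma}{s}\right)\sum_{i=1}^n e_{ii}\otimes e_{ii}+\sum_{i\neq j}\left[\left(1-\frac{\gamma}{\lambda_{ij}}\right)e_{ii}\otimes e_{jj}+\left(\frac{\gamma}{s}+\frac{\gamma}{\lambda_{ij}}\right)e_{ij}\otimes e_{ji}\right]\\&+\gamma\sum_{i\neq j}\frac{\prod_{k\neq i,j}\lambda_{ik}}{\prod_{l\neq j}\lambda_{jl}}\left(e_{ii}\otimes e_{ij}-e_{ij}\otimes e_{ii}\right),\end{aligned}$$ $$D_{12}(u-v;\lambda)=1\otimes1+\sum_{i\neq j}\frac{\gamma}{\lambda_{ij}}(e_{ij}\otimes e_{ji}-e_{ii}\otimes e_{jj})+\frac{\gamma}{s}\sum_{i,j=1}^n e_{ij}\otimes e_{ji}.$$ Then $\hat A,\hat B,\hat C,D$ satisfy the consistency equations for structure matrices of the semi-dynamical reflection equation (with trivial automorphism $g=1$): with $u_a$ the spectral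 parameter of space $a$, and $\hat A_{ab}$, $D_{ab}$ taken at $u_a-u_b$, $$\hat A_{12}\hat A_{13}\hat A_{23}=\hat A_{23}\hat A_{13}\hat A_{12},\qquad \hat A_{12}\,\hat C_{13}\,\hat C_{23}=\hat C_{23}\,\hat C_{13}\,\hat A_{12}(h_3),$$ $$D_{12}\,\hat B_{13}\,\hat B_{23}(h_1)=\hat B_{23}\,\hat B_{13}(h_2)\,D_{12},\qquad D_{12}(h_3)\,D_{13}\,D_{23}(h_1)=D_{23}\,D_{13}(h_2)\,D_{12}.$$ Moreover, let $\hat b(\lambda)$ be the $n\times n$ matrix $$\hat b_{ij}=\frac{\sum_{\alpha\in\mathcal{I}_{ij}}\prod_{l\in\alpha}\lambda_l}{\prod_{k\neq j}\lambda_{jk}},$$ where $\mathcal{I}_{ij}$ is the set of all $(n-i)$-element subsets of $\{1,\dots,n\}\setminus\{j\}$, and let $$\begin{aligned}\hat R_{12}(u-v)=&\left(1+\frac{\gamma}{s}\right)\sum_{i=1}^n e_{ii}\otimes e_{ii}+\sum_{i\neq j}\left(e_{ii}\otimes e_{jj}+\frac{\gamma}{s}\,e_{ij}\otimes e_{ji}\right)\\&+\gamma\sum_{i=1}^n\sum_{k=1}^{i-1}\sum_{j=1}^{i-k}\left(e_{i-k,i}\otimes e_{j+k-1,j}-e_{j+k-1,j}\otimes e_{i-k,i}\right).\end{aligned}$$ Then $\hat R$ satisfies the Yang-Baxter equation $\hat R_{12}(u_1-u_2)\hat R_{13}(u_1-u_3)\hat R_{23}(u_2-u_3)=\hat R_{23}(u_2-u_3)\hat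 R_{13}(u_1-u_3)\hat R_{12}(u_1-u_2)$, and $$\hat B_{12}=\hat b_2^{-1}\,\hat b_2(h_1),\qquad \hat A_{12}=\hat b_1^{-1}\hat b_2^{-1}\,\hat R_{12}\,\hat b_1\hat b_2,\qquad D_{12}=\hat b_1^{-1}(h_2)\,\hat b_2^{-1}\,\hat R_{12}\,\hat b_1\,\hat b_2(h_1).$$
   Context: $\lambda=(\lambda_1,\dots,\lambda_n)$ are complex variables, $\lambda_{ij}=\lambda_i-\lambda_j$; $e_{ij}$ (also $e_{i,j}$) are the standard $n\times n$ matrix units; empty products equal $1$ and empty sums $0$. Subscripts on matrices denote the tensor factors of $\mathbb{C}^n\otimes\mathbb{C}^n(\otimes\mathbb{C}^n)$ in which they act, and $M_{21}$ is $M_{12}$ with the tensor factors exchanged. The dynamical shift: for a matrix-valued function $M(\lambda)$ acting in spaces other than $a$, $M(h_a)$ denotes $\sum_{j=1}^n (e_{jj})_a\,M(\lambda+\gamma\varepsilon_j)$, where $(e_{jj})_a$ acts in space $a$ and $\lambda+\gamma\varepsilon_j$ is $\lambda$ with $\lambda_j$ replaced by $\lambda_j+\gamma$; e.g. $\hat b_2(h_1)=\sum_j e_{jj}\otimes\hat b(\lambda+\gamma\varepsilon_j)$, and $\hat b_1^{-1}(h_2)=\sum_j \hat b^{-1}(\lambda+\gamma\varepsilon_j)\otimes e_{jj}$. Unshifted matrices are at $\lambda$. Identities hold as identities of meromorphic functions. *)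

theory Defs
  imports "HOL-Analysis.Analysis"
begin

text \<open>
  The basis of \<open>\<complex>\<^sup>n\<close> is indexed by a finite linearly ordered type \<open>'n\<close>, \<open>n = CARD('n)\<close>;
  \<open>\<complex>\<^sup>n \<otimes> \<complex>\<^sup>n\<close> and \<open>\<complex>\<^sup>n \<otimes> \<complex>\<^sup>n \<otimes> \<complex>\<^sup>n\<close> then have bases indexed by \<open>'n \<times> 'n\<close> and
  \<open>'n \<times> 'n \<times> 'n\<close>.  The order matters only for \<open>b_hat\<close> and \<open>R_hat\<close>, where the
  indices enter as the numbers \<open>1, \<dots>, n\<close>; these numbers are given by \<open>pos\<close>.
\<close>

type_synonym 'n op1 = "complex^'n^'n"
type_synonym 'n op2 = "complex^('n \<times> 'n)^('n \<times> 'n)"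
type_synonym 'n op3 = "complex^('n \<times> 'n \<times> 'n)^('n \<times> 'n \<times> 'n)"

definition pos :: "'n::{finite,linorder} \<Rightarrow> nat" where
  "pos i = card {..i}"

definition munit :: "'n \<Rightarrow> 'n \<Rightarrow> 'n::finite op1" where
  "munit i j = (\<chi> r c. if r = i \<and> c = j then 1 else 0)"

definition munit_nat :: "nat \<Rightarrow> nat \<Rightarrow> 'n::{finite,linorder} op1" where
  "munit_nat a b = (\<chi> r c. if pos r = a \<and> pos c = b then 1 else 0)"

definition tensor :: "'n::finite op1 \<Rightarrow> 'n op1 \<Rightarrow> 'n op2" (infixr "\<otimes>" 75) where
  "M \<otimes> N = (\<chi> r c. M $ fst r $ fst c * N $ snd r $ snd c)"

definition cscale :: "complex \<Rightarrow> complex^'k^'m \<Rightarrow> complex^'k^'m" (infixr "\<odot>" 70) where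
  "z \<odot> M = (\<chi> r c. z * M $ r $ c)"

definition flip :: "'n::finite op2 \<Rightarrow> 'n op2" where
  "flip M = (\<chi> r c. M $ (snd r, fst r) $ (snd c, fst c))"

abbreviation fst_leg :: "'n::finite op1 \<Rightarrow> 'n op2" where
  "fst_leg M \<equiv> M \<otimes> mat 1"

abbreviation snd_leg :: "'n::finite op1 \<Rightarrow> 'n op2" where
  "snd_leg M \<equiv> mat 1 \<otimes> M"

definition leg1 :: "'n::finite op1 \<Rightarrow> 'n op3" where
  "leg1 M = (\<chi> r c. case (r, c) of ((r1, r2, r3), (c1, c2, c3)) \<Rightarrow>
     if r2 = c2 \<and> r3 = c3 then M $ r1 $ c1 else 0)"

definition leg2 :: "'n::finite op1 \<Rightarrow> 'n op3" where
  "leg2 M = (\<chi> r c. case (r, c) of ((r1, r2, r3), (c1, c2, c3)) \<Rightarrow>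
     if r1 = c1 \<and> r3 = c3 then M $ r2 $ c2 else 0)"

definition leg3 :: "'n::finite op1 \<Rightarrow> 'n op3" where
  "leg3 M = (\<chi> r c. case (r, c) of ((r1, r2, r3), (c1, c2, c3)) \<Rightarrow>
     if r1 = c1 \<and> r2 = c2 then M $ r3 $ c3 else 0)"

definition leg12 :: "'n::finite op2 \<Rightarrow> 'n op3" where
  "leg12 M = (\<chi> r c. case (r, c) of ((r1, r2, r3), (c1, c2, c3)) \<Rightarrow>
     if r3 = c3 then M $ (r1, r2) $ (c1, c2) else 0)"

definition leg13 :: "'n::finite op2 \<Rightarrow> 'n op3" where
  "leg13 M = (\<chi> r c. case (r, c) of ((r1, r2, r3), (c1, c2, c3)) \<Rightarrow>
     if r2 = c2 then M $ (r1, r3) $ (c1, c3) else 0)"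

definition leg23 :: "'n::finite op2 \<Rightarrow> 'n op3" where
  "leg23 M = (\<chi> r c. case (r, c) of ((r1, r2, r3), (c1, c2, c3)) \<Rightarrow>
     if r1 = c1 then M $ (r2, r3) $ (c2, c3) else 0)"

text \<open>
  The dynamical shift \<open>M(h\<^sub>a)\<close>: here \<open>emb\<close> embeds a matrix into space \<open>a\<close>, and the
  values of \<open>M\<close> are already embedded into the full tensor product (acting trivially
  in space \<open>a\<close>).
\<close>

definition dshift ::
  "complex \<Rightarrow> ('n::finite op1 \<Rightarrow> complex^('k::finite)^'k) \<Rightarrow>
   (complex^'n \<Rightarrow> complex^'k^'k) \<Rightarrow> complex^'n \<Rightarrow> complex^'k^'k" where
  "dshift \<gamma> emb M lam = (\<Sum>j\<in>UNIV. emb (munit j j) ** M (lam + axis j \<gamma>))"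

text \<open>
  Identities of meromorphic functions are stated at all points where no factor has a
  vanishing denominator.  \<open>A_hat\<close>, \<open>D_mat\<close>, \<open>b_hat\<close> (and the inverse of \<open>b_hat\<close>) are
  regular for \<open>nonres \<gamma> 0\<close>, \<open>B_hat\<close> for \<open>nonres \<gamma> 1\<close>, and each dynamical shift raises
  the level by one.
\<close>

definition nonres :: "complex \<Rightarrow> nat \<Rightarrow> complex^'n \<Rightarrow> bool" where
  "nonres \<gamma> m lam \<longleftrightarrow>
     (\<forall>i j. i \<noteq> j \<longrightarrow> (\<forall>k::int. \<bar>k\<bar> \<le> int m \<longrightarrow> lam$i - lam$j \<noteq> of_int k * \<gamma>))"

definition p_mat :: "complex \<Rightarrow> complex^'n \<Rightarrow> 'n \<Rightarrow> 'n::finite op1" where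
  "p_mat \<gamma> lam i =
     (\<Prod>k\<in>UNIV-{i}. (lam$i - lam$k) / (lam$i - lam$k + \<gamma>)) \<odot> munit i i
     + (\<Sum>j\<in>UNIV-{i}. munit j j
          - (\<gamma> / (lam$j - lam$i - \<gamma>) *
               (\<Prod>k\<in>UNIV-{i,j}. (lam$i - lam$k) / (lam$j - lam$k))) \<odot> munit i j)"

definition B_hat :: "complex \<Rightarrow> complex^'n \<Rightarrow> 'n::finite op2" where
  "B_hat \<gamma> lam = (\<Sum>i\<in>UNIV. munit i i \<otimes> p_mat \<gamma> lam i)"

definition C_hat :: "complex \<Rightarrow> complex^'n \<Rightarrow> 'n::finite op2" where
  "C_hat \<gamma> lam = flip (B_hat \<gamma> lam)"

definition A_hat :: "complex \<Rightarrow> complex \<Rightarrow> complex^'n \<Rightarrow> 'n::finite op2" where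
  "A_hat \<gamma> s lam =
     (1 + \<gamma> / s) \<odot> (\<Sum>i\<in>UNIV. munit i i \<otimes> munit i i)
     + (\<Sum>i\<in>UNIV. \<Sum>j\<in>UNIV-{i}.
          (1 - \<gamma> / (lam$i - lam$j)) \<odot> (munit i i \<otimes> munit j j)
          + (\<gamma> / s + \<gamma> / (lam$i - lam$j)) \<odot> (munit i j \<otimes> munit j i))
     + \<gamma> \<odot> (\<Sum>i\<in>UNIV. \<Sum>j\<in>UNIV-{i}.
          ((\<Prod>k\<in>UNIV-{i,j}. lam$i - lam$k) / (\<Prod>l\<in>UNIV-{j}. lam$j - lam$l))
            \<odot> (munit i i \<otimes> munit i j - munit i j \<otimes> munit i i))"

definition D_mat :: "complex \<Rightarrow> complex \<Rightarrow> complex^'n \<Rightarrow> 'n::finite op2" where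
  "D_mat \<gamma> s lam =
     mat 1 \<otimes> mat 1
     + (\<Sum>i\<in>UNIV. \<Sum>j\<in>UNIV-{i}.
          (\<gamma> / (lam$i - lam$j)) \<odot> (munit i j \<otimes> munit j i - munit i i \<otimes> munit j j))
     + (\<gamma> / s) \<odot> (\<Sum>i\<in>UNIV. \<Sum>j\<in>UNIV. munit i j \<otimes> munit j i)"

definition b_hat :: "complex^'n::{finite,linorder} \<Rightarrow> 'n op1" where
  "b_hat lam = (\<chi> i j.
     (\<Sum>\<alpha> | \<alpha> \<subseteq> UNIV-{j} \<and> card \<alpha> = CARD('n) - pos i. \<Prod>l\<in>\<alpha>. lam$l)
       / (\<Prod>k\<in>UNIV-{j}. lam$j - lam$k))"

definition R_hat :: "complex \<Rightarrow> complex \<Rightarrow> 'n::{finite,linorder} op2" where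
  "R_hat \<gamma> s =
     (1 + \<gamma> / s) \<odot> (\<Sum>i\<in>UNIV. munit i i \<otimes> munit i i)
     + (\<Sum>i\<in>UNIV. \<Sum>j\<in>UNIV-{i}.
          munit i i \<otimes> munit j j + (\<gamma> / s) \<odot> (munit i j \<otimes> munit j i))
     + \<gamma> \<odot> (\<Sum>i=1..CARD('n). \<Sum>k=1..i-1. \<Sum>j=1..i-k.
          munit_nat (i-k) i \<otimes> munit_nat (j+k-1) j
          - munit_nat (j+k-1) j \<otimes> munit_nat (i-k) i)"

end

theory Submission
  imports Defs
begin

text \<open>
  Let \<open>v(x)\<close> be the row vector with entries \<open>(-1)\<^sup>n\<^sup>-\<^sup>r x\<^sup>r\<^sup>-\<^sup>1\<close>.  Then \<open>v(x) b(\<lambda>)\<close> is the row of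
  Lagrange basis polynomials with nodes \<open>\<lambda>\<^sub>j\<close>, evaluated at \<open>x\<close>; hence the inverse of \<open>b(\<lambda>)\<close> has
  the rows \<open>v(\<lambda>\<^sub>i)\<close>, and the products \<open>b(\<lambda>)\<^sup>-\<^sup>1 b(\<mu>)\<close> are interpolation matrices.  In this picture
  \<open>R\<close> is the operator \<open>1 + (\<gamma>/s) P - \<gamma> \<partial>\<close> on polynomials in two variables, with \<open>P\<close> the exchange
  of variables and \<open>\<partial> = (1 - P) / (x - y)\<close> the divided difference.  At pairwise distinct
  points its Yang-Baxter equation is an identity of rational functions, and such points separate
  matrices.  \<open>A\<close>, \<open>B\<close>, \<open>D\<close> are obtained by evaluating at the nodes, the diagonal rows of \<open>A\<close>
  being limits of divided differences.  The relation between \<open>A\<close> and \<open>C\<close> then holds separately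
  for each index of the third factor.  The relation between \<open>D\<close> and \<open>B\<close> holds since
  \<open>b(\<lambda>)\<^sup>-\<^sup>1 b(\<lambda> + \<gamma>\<epsilon>\<^sub>i + \<gamma>\<epsilon>\<^sub>j)\<close> is symmetric in \<open>i, j\<close> and \<open>D\<close> only mixes \<open>(i, j)\<close> with \<open>(j, i)\<close>.
  For distinct indices the dynamical equation of \<open>D\<close> is the rational identity behind \<open>R\<close> again.
\<close>


section \<open>A braid identity for permutation operators\<close>

text \<open>The action of \<open>R_hat\<close> at three points, with labels of an arbitrary type in
  place of the points. Taking \<open>x\<close> to be the identity gives the equation of
  \<open>R_hat\<close>; \<open>x i = lam $ i\<close> gives the dynamical equation of
  \<open>D_mat\<close> at distinct indices.\<close>

definition ybe_op12 :: "complex \<Rightarrow> ('a \<Rightarrow> complex) \<Rightarrow> complex \<Rightarrow> ('a \<Rightarrow> 'a \<Rightarrow> 'a \<Rightarrow> complex) \<Rightarrow> 'a \<Rightarrow> 'a \<Rightarrow> 'a \<Rightarrow> complex" where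
  "ybe_op12 \<gamma> x s f i j k = (1 - \<gamma> / (x i - x j)) * f i j k + (\<gamma> / s + \<gamma> / (x i - x j)) * f j i k"

definition ybe_op13 :: "complex \<Rightarrow> ('a \<Rightarrow> complex) \<Rightarrow> complex \<Rightarrow> ('a \<Rightarrow> 'a \<Rightarrow> 'a \<Rightarrow> complex) \<Rightarrow> 'a \<Rightarrow> 'a \<Rightarrow> 'a \<Rightarrow> complex" where
  "ybe_op13 \<gamma> x s f i j k = (1 - \<gamma> / (x i - x k)) * f i j k + (\<gamma> / s + \<gamma> / (x i - x k)) * f k j i"

definition ybe_op23 :: "complex \<Rightarrow> ('a \<Rightarrow> complex) \<Rightarrow> complex \<Rightarrow> ('a \<Rightarrow> 'a \<Rightarrow> 'a \<Rightarrow> complex) \<Rightarrow> 'a \<Rightarrow> 'a \<Rightarrow> 'a \<Rightarrow> complex" where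
  "ybe_op23 \<gamma> x s f i j k = (1 - \<gamma> / (x j - x k)) * f i j k + (\<gamma> / s + \<gamma> / (x j - x k)) * f i k j"

text \<open>Both sides are polynomials in six quotients with numerator \<gamma>. The denominators
  satisfy the additive relations (s) + (t) = s + t and (x i - x j) + (x j - x k) = x i - x k. As the
  quadratic relations \<open>1\<close> and \<open>2\<close> between the quotients, these imply the
  identity.\<close>

lemma ybe_op_braid:
  fixes s t :: complex
  assumes "s \<noteq> 0" "t \<noteq> 0" "s + t \<noteq> 0" "x i \<noteq> x j" "x j \<noteq> x k" "x i \<noteq> x k"
  shows "ybe_op12 \<gamma> x s (ybe_op13 \<gamma> x (s + t) (ybe_op23 \<gamma> x t f)) i j k
       = ybe_op23 \<gamma> x t (ybe_op13 \<gamma> x (s + t) (ybe_op12 \<gamma> x s f)) i j k"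
proof -
  define a b c p q r where "a = \<gamma> / s" and "b = \<gamma> / t" and "c = \<gamma> / (s + t)"
    and "p = \<gamma> / (x i - x j)" and "q = \<gamma> / (x j - x k)" and "r = \<gamma> / (x i - x k)"
  have *: "\<gamma> / (x j - x i) = - p" "\<gamma> / (x k - x j) = - q" "\<gamma> / (x k - x i) = - r"
    unfolding p_def q_def r_def by (metis minus_diff_eq minus_divide_right)+
  have 1: "a * b = c * (a + b)"
    using assms by (simp add: a_def b_def c_def divide_simps) (simp add: algebra_simps)
  have 2: "p * q = r * (p + q)"
    using assms by (simp add: p_def q_def r_def divide_simps) (simp add: algebra_simps)
  show ?thesis
    unfolding ybe_op12_def ybe_op13_def ybe_op23_def *
      a_def[symmetric] b_def[symmetric] c_def[symmetric]
      p_def[symmetric] q_def[symmetric] r_def[symmetric]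
    using 1 2 by algebra
qed

section \<open>Lagrange interpolation and the inverse of \<open>b_hat\<close>\<close>

lemma pos_le: "pos (i :: 'n::{finite,linorder}) \<le> CARD('n)"
  and pos_ge: "1 \<le> pos i"
proof -
  show "pos i \<le> CARD('n)" unfolding pos_def by (rule card_mono) auto
  have "pos i \<noteq> 0" unfolding pos_def by (subst card_0_eq) auto
  then show "1 \<le> pos i" by simp
qed

lemma bij_betw_pos: "bij_betw pos (UNIV :: 'n::{finite,linorder} set) {1..CARD('n)}"
proof -
  have "strict_mono (pos :: 'n \<Rightarrow> nat)"
    unfolding strict_mono_def pos_def by (auto intro!: psubset_card_mono)
  then have inj: "inj (pos :: 'n \<Rightarrow> nat)" by (rule strict_mono_imp_inj_on)
  have "pos ` (UNIV :: 'n set) = {1..CARD('n)}"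
    by (rule card_subset_eq) (use pos_le pos_ge inj in \<open>auto simp: card_image\<close>)
  with inj show ?thesis by (simp add: bij_betw_def)
qed

lemma pos_eq_iff [simp]: "pos i = pos j \<longleftrightarrow> i = j"
  using bij_betw_pos by (metis UNIV_I bij_betw_inv_into_left)

lemma sum_pos: "(\<Sum>r\<in>(UNIV :: 'n::{finite,linorder} set). f (pos r)) = (\<Sum>a=1..CARD('n). f a)"
  by (rule sum.reindex_bij_betw[OF bij_betw_pos])

text \<open>The sign is that of the elementary symmetric polynomial of degree n - a as coefficient
  of t^(a-1) in a product of n - 1 factors t - lam_k. The index is a number because
  \<open>R_hat\<close> does arithmetic on indices.\<close>

definition moment_nat :: "nat \<Rightarrow> complex \<Rightarrow> nat \<Rightarrow> complex" where
  "moment_nat n t a = (-1) ^ (n - a) * t ^ (a - 1)"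

definition moment :: "complex \<Rightarrow> complex^'n::{finite,linorder}" where
  "moment t = (\<chi> r. moment_nat CARD('n) t (pos r))"

definition lagrange :: "complex^'n::finite \<Rightarrow> complex \<Rightarrow> complex^'n" where
  "lagrange lam t = (\<chi> j. \<Prod>k\<in>UNIV-{j}. (t - lam$k) / (lam$j - lam$k))"

text \<open>Vieta: up to sign, the numerators in column j of \<open>b_hat\<close> are the
  coefficients of the product of t - lam_k over k \<noteq> j. Pairing them with the signed powers of
  t restores this polynomial, and the common denominator is its value at lam_j.\<close>

lemma moment_b_hat: "moment t v* b_hat lam = lagrange lam t" for lam :: "complex^'n::{finite,linorder}"
proof (rule vec_eq_iff[THEN iffD2], rule allI)
  fix j :: 'n
  let ?S = "\<lambda>m. {\<alpha>. \<alpha> \<subseteq> UNIV - {j} \<and> card \<alpha> = m}"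
  let ?n = "CARD('n)"
  have cU: "card (UNIV - {j}) = ?n - 1" by (simp add: card_Diff_singleton)
  have card_le: "card \<alpha> \<le> ?n - 1" if "\<alpha> \<subseteq> UNIV - {j}" for \<alpha>
    using card_mono[OF _ that] cU by simp
  obtain N where N: "?n = Suc N" using zero_less_card_finite gr0_implies_Suc by blast
  have "(\<Prod>k\<in>UNIV-{j}. t - lam$k) = (\<Prod>k\<in>UNIV-{j}. - lam$k + t)" by (simp add: algebra_simps)
  also have "\<dots> = (\<Sum>\<alpha>\<in>Pow (UNIV-{j}). (\<Prod>l\<in>\<alpha>. - lam$l) * (\<Prod>l\<in>UNIV-{j}-\<alpha>. t))"
    by (rule prod_add) simp
  also have "\<dots> = (\<Sum>\<alpha>\<in>Pow (UNIV-{j}). (-1) ^ card \<alpha> * t ^ (?n - 1 - card \<alpha>) * (\<Prod>l\<in>\<alpha>. lam$l))"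
  proof (rule sum.cong[OF refl])
    fix \<alpha> assume \<alpha>: "\<alpha> \<in> Pow (UNIV - {j})"
    then have "card (UNIV - {j} - \<alpha>) = ?n - 1 - card \<alpha>"
      using cU by (subst card_Diff_subset) auto
    then show "(\<Prod>l\<in>\<alpha>. - lam$l) * (\<Prod>l\<in>UNIV-{j}-\<alpha>. t)
      = (-1) ^ card \<alpha> * t ^ (?n - 1 - card \<alpha>) * (\<Prod>l\<in>\<alpha>. lam$l)"
      using prod.distrib[of "\<lambda>_. -1" "\<lambda>l. lam$l" \<alpha>] by simp
  qed
  \<comment> \<open>Subsets of equal size m share sign and power of t, so the elementary symmetric
    polynomials appear; afterwards m = n - a.\<close>
  also have "\<dots> = (\<Sum>m\<in>{0..?n-1}. \<Sum>\<alpha> | \<alpha> \<in> Pow (UNIV-{j}) \<and> card \<alpha> = m.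
       (-1) ^ card \<alpha> * t ^ (?n - 1 - card \<alpha>) * (\<Prod>l\<in>\<alpha>. lam$l))"
    by (rule sum.group[symmetric]) (use card_le in auto)
  also have "\<dots> = (\<Sum>m\<in>{0..?n-1}. (-1) ^ m * t ^ (?n - 1 - m) * (\<Sum>\<alpha>\<in>?S m. \<Prod>l\<in>\<alpha>. lam$l))"
    by (auto simp: sum_distrib_left intro!: sum.cong)
  also have "\<dots> = (\<Sum>a=1..?n. (-1) ^ (?n - a) * t ^ (a - 1) * (\<Sum>\<alpha>\<in>?S (?n - a). \<Prod>l\<in>\<alpha>. lam$l))"
    by (rule sum.reindex_bij_witness[of _ "\<lambda>a. ?n - a" "\<lambda>m. ?n - m"]) (auto simp: N)
  also have "\<dots> = (\<Sum>r\<in>UNIV. moment_nat ?n t (pos r) * (\<Sum>\<alpha>\<in>?S (?n - pos (r :: 'n)). \<Prod>l\<in>\<alpha>. lam$l))"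
    by (subst sum_pos[symmetric]) (simp add: moment_nat_def)
  finally have eq: "(\<Prod>k\<in>UNIV-{j}. t - lam$k)
     = (\<Sum>r\<in>UNIV. moment_nat ?n t (pos r) * (\<Sum>\<alpha>\<in>?S (?n - pos (r :: 'n)). \<Prod>l\<in>\<alpha>. lam$l))" .
  show "(moment t v* b_hat lam) $ j = lagrange lam t $ j"
    by (simp add: lagrange_def prod_dividef eq vector_matrix_mult_def b_hat_def moment_def)
      (subst sum_divide_distrib, rule refl)
qed

lemma lagrange_node:
  assumes "nonres \<gamma> 0 lam"
  shows "lagrange lam (lam $ i) = axis i 1"
proof -
  have "lagrange lam (lam $ i) $ j = axis i 1 $ j" for j
  proof (cases "i = j")
    case True
    then show ?thesis using assms by (auto simp: lagrange_def nonres_def intro!: prod.neutral)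
  next
    case False
    then have "(\<Prod>k\<in>UNIV-{j}. (lam$i - lam$k) / (lam$j - lam$k)) = 0"
      by (intro prod_zero) auto
    with False show ?thesis by (simp add: lagrange_def axis_def)
  qed
  then show ?thesis by (simp add: vec_eq_iff)
qed

definition vandermonde :: "complex^'n::{finite,linorder} \<Rightarrow> 'n op1" where
  "vandermonde lam = (\<chi> i. moment (lam $ i))"

lemma vandermonde_b_hat:
  assumes "nonres \<gamma> 0 lam"
  shows "vandermonde lam ** b_hat lam = mat 1" "b_hat lam ** vandermonde lam = mat 1"
proof -
  have "(vandermonde lam ** b_hat lam) $ i = mat 1 $ i" for i
  proof -
    have "(vandermonde lam ** b_hat lam) $ i = moment (lam $ i) v* b_hat lam"
      by (simp add: vec_eq_iff matrix_matrix_mult_def vector_matrix_mult_def vandermonde_def mult.commute)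
    also have "\<dots> = mat 1 $ i"
      by (simp add: moment_b_hat lagrange_node[OF assms]) (simp add: vec_eq_iff axis_def mat_def)
    finally show ?thesis .
  qed
  then show 1: "vandermonde lam ** b_hat lam = mat 1" by (simp add: vec_eq_iff)
  then show "b_hat lam ** vandermonde lam = mat 1" by (simp add: matrix_left_right_inverse)
qed

lemma matrix_inv_b_hat:
  assumes "nonres \<gamma> 0 lam"
  shows "matrix_inv (b_hat lam) = vandermonde lam"
proof -
  have "b_hat lam ** matrix_inv (b_hat lam) = mat 1"
    using vandermonde_b_hat[OF assms]
    unfolding matrix_inv_def by (metis (mono_tags, lifting) someI_ex)
  then show ?thesis
    by (metis vandermonde_b_hat(1)[OF assms] matrix_mul_assoc matrix_mul_lid matrix_mul_rid)
qed

section \<open>Non-resonance under shifts\<close>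

lemma nonres_mono: "nonres \<gamma> m lam \<Longrightarrow> k \<le> m \<Longrightarrow> nonres \<gamma> k lam"
  unfolding nonres_def by fastforce

lemma nonres_shift:
  assumes "nonres \<gamma> (Suc m) lam"
  shows "nonres \<gamma> m (lam + axis l \<gamma>)"
  unfolding nonres_def
proof (intro allI impI)
  fix i j :: 'a and k :: int
  assume ij: "i \<noteq> j" and k: "\<bar>k\<bar> \<le> int m"
  have ne: "lam$i - lam$j \<noteq> of_int k' * \<gamma>" if "\<bar>k'\<bar> \<le> int (Suc m)" for k'
    using assms ij that unfolding nonres_def by blast
  \<comment> \<open>Since i \<noteq> j, the shift moves at most one of the two coordinates, so the
    difference changes by at most one multiple of \<gamma> in either direction.\<close>
  define d :: int where "d = (if i = l then 1 else if j = l then -1 else 0)"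
  have "(lam + axis l \<gamma>)$i - (lam + axis l \<gamma>)$j = lam$i - lam$j + of_int d * \<gamma>"
    using ij by (auto simp: d_def axis_def)
  moreover have "lam$i - lam$j \<noteq> of_int (k - d) * \<gamma>"
    using k by (intro ne) (auto simp: d_def)
  ultimately show "(lam + axis l \<gamma>)$i - (lam + axis l \<gamma>)$j \<noteq> of_int k * \<gamma>"
    by (simp add: algebra_simps)
qed

section \<open>Matrix entries\<close>

definition vtensor :: "complex^'n::finite \<Rightarrow> complex^'n \<Rightarrow> complex^('n \<times> 'n)" where
  "vtensor v w = (\<chi> r. v $ fst r * w $ snd r)"

lemma vtensor_nth [simp]: "vtensor v w $ (a, b) = v $ a * w $ b"
  by (simp add: vtensor_def)

lemma tensor_nth [simp]: "(M \<otimes> N) $ (a, b) $ (c, d) = M $ a $ c * N $ b $ d"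
  by (simp add: tensor_def)

lemma cscale_nth [simp]: "(z \<odot> M) $ r $ c = z * M $ r $ c"
  by (simp add: cscale_def)

lemma munit_nth: "munit i j $ a $ b = (if a = i \<and> b = j then 1 else 0)"
  by (simp add: munit_def)

lemma mat_nth: "mat k $ i $ j = (if i = j then k else 0)"
  by (simp add: mat_def)

lemma sum_UNIV_pair: "(\<Sum>p\<in>UNIV. f p) = (\<Sum>a\<in>UNIV. \<Sum>b\<in>UNIV. f (a, b))"
  by (simp add: sum.cartesian_product)

lemma tensor_mult: "(M \<otimes> N) ** (M' \<otimes> N') = (M ** M') \<otimes> (N ** N')"
proof -
  have "((M \<otimes> N) ** (M' \<otimes> N')) $ (a, b) $ (c, d) = ((M ** M') \<otimes> (N ** N')) $ (a, b) $ (c, d)" for a b c d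
    by (simp add: matrix_matrix_mult_def sum_UNIV_pair sum_product mult.assoc mult.left_commute)
  then show ?thesis by (simp add: vec_eq_iff)
qed

lemma tensor_mat_1 [simp]: "mat 1 \<otimes> mat 1 = mat 1"
  by (auto simp: vec_eq_iff mat_nth)

lemma vtensor_tensor: "vtensor v w v* (M \<otimes> N) = vtensor (v v* M) (w v* N)"
proof -
  have "(vtensor v w v* (M \<otimes> N)) $ (c, d) = vtensor (v v* M) (w v* N) $ (c, d)" for c d
    by (simp add: vector_matrix_mult_def sum_UNIV_pair sum_product mult.assoc mult.left_commute)
  then show ?thesis by (simp add: vec_eq_iff)
qed

lemma row_matrix_mult: "(M ** N) $ r = M $ r v* N"
  by (simp add: vec_eq_iff matrix_matrix_mult_def vector_matrix_mult_def)

lemma vector_matrix_cscale: "v v* (z \<odot> M) = z *s (v v* M)"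
  by (simp add: vec_eq_iff vector_matrix_mult_def sum_distrib_left mult.left_commute)

lemma vector_matrix_sum: "v v* (\<Sum>i\<in>A. M i) = (\<Sum>i\<in>A. v v* M i)" for M :: "'a \<Rightarrow> complex^'k^'m"
  by (induction A rule: infinite_finite_induct) (simp_all add: vector_matrix_mult_add_rdistrib)

text \<open>An entry of a sum of matrix units over i \<noteq> j receives at most one term. The pair
  (p, q) read off from the entry may lie on the diagonal, outside the range of summation; hence the
  case distinction.\<close>

lemma sum_off_diagonal_single:
  fixes h :: "'n::finite \<Rightarrow> 'n \<Rightarrow> complex"
  assumes "\<And>i j. i \<noteq> j \<Longrightarrow> \<not> (i = p \<and> j = q) \<Longrightarrow> h i j = 0"
  shows "(\<Sum>i\<in>UNIV. \<Sum>j\<in>UNIV-{i}. h i j) = (if p \<noteq> q then h p q else 0)"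
proof -
  have "(\<Sum>j\<in>UNIV-{i}. h i j) = (if i = p then if p \<noteq> q then h p q else 0 else 0)" for i
  proof (cases "i = p \<and> p \<noteq> q")
    case True
    then have "(\<Sum>j\<in>UNIV-{i}. h i j) = (\<Sum>j\<in>{q}. h i j)"
      by (intro sum.mono_neutral_right) (auto intro!: assms)
    with True show ?thesis by simp
  next
    case False
    then have "(\<Sum>j\<in>UNIV-{i}. h i j) = 0" by (intro sum.neutral) (auto intro!: assms)
    with False show ?thesis by auto
  qed
  then show ?thesis by simp
qed

lemma sum_munit_diag:
  "(\<Sum>i\<in>UNIV. munit i i $ a $ c * munit i i $ b $ d) = (if a = c \<and> b = d \<and> a = b then 1 else 0)"
proof -
  have "(\<Sum>i\<in>UNIV. munit i i $ a $ c * munit i i $ b $ d)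
      = (\<Sum>i\<in>UNIV. if i = a then if a = c \<and> b = d \<and> a = b then 1 else 0 else 0)"
    by (rule sum.cong) (auto simp: munit_nth)
  then show ?thesis by simp
qed

lemma sum_munit_all:
  "(\<Sum>i\<in>UNIV. \<Sum>j\<in>UNIV. munit i j $ a $ c * munit j i $ b $ d) = (if a = d \<and> b = c then 1 else 0)"
proof -
  have "(\<Sum>i\<in>UNIV. \<Sum>j\<in>UNIV. munit i j $ a $ c * munit j i $ b $ d)
      = (\<Sum>i\<in>UNIV. \<Sum>j\<in>UNIV. if j = c then if i = a then if a = d \<and> b = c then 1 else 0 else 0 else 0)"
    by (intro sum.cong) (auto simp: munit_nth)
  then show ?thesis by simp
qed

lemma sum_munit_off_diagonal:
  fixes g :: "'n::finite \<Rightarrow> 'n \<Rightarrow> complex"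
  shows "(\<Sum>i\<in>UNIV. \<Sum>j\<in>UNIV-{i}. g i j * (munit i i $ a $ c * munit j j $ b $ d))
      = (if a = c \<and> b = d \<and> a \<noteq> b then g a b else 0)" (is ?T1)
    and "(\<Sum>i\<in>UNIV. \<Sum>j\<in>UNIV-{i}. g i j * (munit i j $ a $ c * munit j i $ b $ d))
      = (if a = d \<and> b = c \<and> a \<noteq> b then g a b else 0)" (is ?T2)
    and "(\<Sum>i\<in>UNIV. \<Sum>j\<in>UNIV-{i}. g i j * (munit i i $ a $ c * munit i j $ b $ d))
      = (if a = b \<and> a = c \<and> a \<noteq> d then g a d else 0)" (is ?T3)
    and "(\<Sum>i\<in>UNIV. \<Sum>j\<in>UNIV-{i}. g i j * (munit i j $ a $ c * munit i i $ b $ d))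
      = (if a = b \<and> a = d \<and> a \<noteq> c then g a c else 0)" (is ?T4)
proof -
  show ?T1 by (subst sum_off_diagonal_single[of a b]) (auto simp: munit_nth)
  show ?T2 by (subst sum_off_diagonal_single[of a b]) (auto simp: munit_nth)
  show ?T3 by (subst sum_off_diagonal_single[of a d]) (auto simp: munit_nth)
  show ?T4 by (subst sum_off_diagonal_single[of a c]) (auto simp: munit_nth)
qed

text \<open>Since \<open>\<gamma> / 0 = 0\<close>, the formula also covers the entries with \<open>a = b\<close>.\<close>

lemma D_mat_nth:
  "D_mat \<gamma> s lam $ (a, b) $ (c, d)
     = (1 - \<gamma> / (lam$a - lam$b)) * (if a = c \<and> b = d then 1 else 0)
     + (\<gamma> / s + \<gamma> / (lam$a - lam$b)) * (if a = d \<and> b = c then 1 else 0)"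
proof -
  let ?g = "\<lambda>i j. \<gamma> / (lam$i - lam$j)"
  have "D_mat \<gamma> s lam $ (a, b) $ (c, d) = mat 1 $ a $ c * mat 1 $ b $ d
      + ((\<Sum>i\<in>UNIV. \<Sum>j\<in>UNIV-{i}. ?g i j * (munit i j $ a $ c * munit j i $ b $ d))
        - (\<Sum>i\<in>UNIV. \<Sum>j\<in>UNIV-{i}. ?g i j * (munit i i $ a $ c * munit j j $ b $ d)))
      + \<gamma> / s * (\<Sum>i\<in>UNIV. \<Sum>j\<in>UNIV. munit i j $ a $ c * munit j i $ b $ d)"
    unfolding D_mat_def vector_add_component vector_minus_component sum_component cscale_nth tensor_nth
    unfolding right_diff_distrib
    unfolding sum_subtractf
    by (rule refl)
  then show ?thesis
    unfolding sum_munit_off_diagonal sum_munit_all mat_nth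
    by (cases "a = b"; cases "a = c"; cases "b = d"; cases "a = d"; cases "b = c") (simp_all add: left_diff_distrib)
qed

text \<open>For i \<noteq> j this is the derivative at the node lam_i of the Lagrange polynomial
  belonging to lam_j.\<close>

definition diag_weight :: "complex^'n::finite \<Rightarrow> 'n \<Rightarrow> 'n \<Rightarrow> complex" where
  "diag_weight lam i j = (\<Prod>k\<in>UNIV-{i,j}. lam$i - lam$k) / (\<Prod>l\<in>UNIV-{j}. lam$j - lam$l)"

text \<open>The rows with a \<noteq> b coincide with those of \<open>D_mat\<close>. The rows with a
  = b carry the derivative weights and are the ones that later require a limit.\<close>

lemma A_hat_nth:
  "A_hat \<gamma> s lam $ (a, b) $ (c, d) =
     (if a = b then (1 + \<gamma> / s) * (if a = c \<and> a = d then 1 else 0)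
         + \<gamma> * ((if a = c \<and> a \<noteq> d then diag_weight lam a d else 0)
              - (if a = d \<and> a \<noteq> c then diag_weight lam a c else 0))
      else (1 - \<gamma> / (lam$a - lam$b)) * (if a = c \<and> b = d then 1 else 0)
         + (\<gamma> / s + \<gamma> / (lam$a - lam$b)) * (if a = d \<and> b = c then 1 else 0))"
proof -
  let ?g = "\<lambda>i j. \<gamma> / (lam$i - lam$j)"
  have "A_hat \<gamma> s lam $ (a, b) $ (c, d) =
      (1 + \<gamma> / s) * (\<Sum>i\<in>UNIV. munit i i $ a $ c * munit i i $ b $ d)
      + ((\<Sum>i\<in>UNIV. \<Sum>j\<in>UNIV-{i}. (1 - ?g i j) * (munit i i $ a $ c * munit j j $ b $ d))
        + (\<Sum>i\<in>UNIV. \<Sum>j\<in>UNIV-{i}. (\<gamma> / s + ?g i j) * (munit i j $ a $ c * munit j i $ b $ d)))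
      + \<gamma> * ((\<Sum>i\<in>UNIV. \<Sum>j\<in>UNIV-{i}. diag_weight lam i j * (munit i i $ a $ c * munit i j $ b $ d))
        - (\<Sum>i\<in>UNIV. \<Sum>j\<in>UNIV-{i}. diag_weight lam i j * (munit i j $ a $ c * munit i i $ b $ d)))"
    unfolding A_hat_def diag_weight_def[symmetric] vector_add_component vector_minus_component
      sum_component cscale_nth tensor_nth
    unfolding right_diff_distrib
    unfolding sum_subtractf sum.distrib
    unfolding right_diff_distrib
    by (rule refl)
  then show ?thesis
    unfolding sum_munit_off_diagonal sum_munit_diag
    by (cases "a = b"; cases "a = c"; cases "b = d"; cases "a = d"; cases "b = c") simp_all
qed

section \<open>\<open>R_hat\<close> as a divided difference operator\<close>

lemma moment_munit_nat:
  assumes "1 \<le> p" "p \<le> CARD('n)"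
  shows "(moment t v* munit_nat p q :: complex^'n::{finite,linorder}) $ c
    = (if pos c = q then moment_nat CARD('n) t p else 0)"
proof -
  obtain r :: 'n where r: "pos r = p"
    using bij_betw_pos[where ?'n = 'n] assms by (metis atLeastAtMost_iff bij_betw_apply bij_betw_inv_into bij_betw_inv_into_right)
  show ?thesis
    unfolding vector_matrix_mult_def
    by (simp add: munit_nat_def moment_def r[symmetric] if_distrib[of "(*) _"] cong: if_cong)
qed

text \<open>After extracting the sign and the factor (x y)^(q-1), this is the geometric sum for x^m
  - y^m with m = p - q.\<close>

lemma moment_nat_divided_difference:
  assumes "1 \<le> q" "q \<le> p" "p \<le> n"
  shows "(x - y) * (\<Sum>k=1..p-q. moment_nat n x (p - k) * moment_nat n y (q + k - 1))
    = moment_nat n x q * moment_nat n y p - moment_nat n x p * moment_nat n y q"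
proof -
  obtain m where m: "p = q + m" using assms by (metis le_iff_add)
  obtain r where r: "q = Suc r" using assms by (cases q) auto
  \<comment> \<open>Equal parity of n - a and n + a removes the truncated subtraction from the
    exponents.\<close>
  have sgn: "(-1::complex) ^ (n - a) = (-1) ^ (n + a)" if "a \<le> n" for a
    using that by (simp add: minus_one_power_iff)
  have "(\<Sum>k=1..p-q. moment_nat n x (p - k) * moment_nat n y (q + k - 1))
      = (\<Sum>k=1..m. - ((-1) ^ m) * (x * y) ^ r * (y ^ (k - 1) * x ^ (m - k)))"
  proof (rule sum.cong)
    fix k assume k: "k \<in> {1..m}"
    then obtain l where l: "k = Suc l" by (cases k) auto
    from k l obtain h where h: "m = Suc l + h" by (metis atLeastAtMost_iff le_iff_add)
    show "moment_nat n x (p - k) * moment_nat n y (q + k - 1)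
        = - ((-1) ^ m) * (x * y) ^ r * (y ^ (k - 1) * x ^ (m - k))"
      using assms by (simp add: moment_nat_def m r l h sgn power_add power_mult_distrib minus_one_power_iff)
  qed (simp add: m)
  also have "\<dots> = (\<Sum>i<m. - ((-1) ^ m) * (x * y) ^ r * (y ^ (m - Suc i) * x ^ i))"
    by (rule sum.reindex_bij_witness[of _ "\<lambda>i. m - i" "\<lambda>k. m - k"]) auto
  finally have "(x - y) * (\<Sum>k=1..p-q. moment_nat n x (p - k) * moment_nat n y (q + k - 1))
      = - ((-1) ^ m) * (x * y) ^ r * (x ^ m - y ^ m)"
    by (simp add: power_diff_sumr2 sum_distrib_left sum_distrib_right mult_ac sum_negf)
  also have "\<dots> = moment_nat n x q * moment_nat n y p - moment_nat n x p * moment_nat n y q"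
    using assms by (simp add: moment_nat_def m r sgn power_add power_mult_distrib algebra_simps minus_one_power_iff)
  finally show ?thesis .
qed

definition swap_mat :: "'n::finite op2" where
  "swap_mat = (\<chi> r c. if r = (snd c, fst c) then 1 else 0)"

lemma vtensor_swap_mat: "vtensor v w v* swap_mat = vtensor w v"
proof -
  have "(vtensor v w v* swap_mat) $ (c, d) = vtensor w v $ (c, d)" for c d
    by (simp add: vector_matrix_mult_def swap_mat_def if_distrib[of "(*) _"] cong: if_cong)
  then show ?thesis by (simp add: vec_eq_iff)
qed

text \<open>The first sum of \<open>R_hat\<close> holds the diagonal parts of both the identity and
  the exchange of factors, the second sum their remaining parts.\<close>

lemma R_hat_eq:
  "R_hat \<gamma> s = (mat 1 + (\<gamma> / s) \<odot> swap_mat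
     + \<gamma> \<odot> (\<Sum>i=1..CARD('n). \<Sum>k=1..i-1. \<Sum>j=1..i-k.
          munit_nat (i-k) i \<otimes> munit_nat (j+k-1) j
          - munit_nat (j+k-1) j \<otimes> munit_nat (i-k) i) :: 'n::{finite,linorder} op2)"
proof -
  have "((1 + \<gamma> / s) \<odot> (\<Sum>i\<in>UNIV. munit i i \<otimes> munit i i)
     + (\<Sum>i\<in>UNIV. \<Sum>j\<in>UNIV-{i}.
          munit i i \<otimes> munit j j + (\<gamma> / s) \<odot> (munit i j \<otimes> munit j i)) :: 'n op2) $ (a, b) $ (c, d)
     = (mat 1 + (\<gamma> / s) \<odot> swap_mat) $ (a, b) $ (c, d)" (is "?l $ _ $ _ = _") for a b c d :: 'n
  proof -
    have "?l $ (a, b) $ (c, d) =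
      (1 + \<gamma> / s) * (\<Sum>i\<in>UNIV. munit i i $ a $ c * munit i i $ b $ d)
      + ((\<Sum>i\<in>UNIV. \<Sum>j\<in>UNIV-{i}. 1 * (munit i i $ a $ c * munit j j $ b $ d))
        + (\<Sum>i\<in>UNIV. \<Sum>j\<in>UNIV-{i}. \<gamma> / s * (munit i j $ a $ c * munit j i $ b $ d)))"
      by (simp add: sum.distrib)
    then show ?thesis
      unfolding sum_munit_off_diagonal sum_munit_diag
      by (cases "a = b"; cases "a = c"; cases "b = d"; cases "a = d"; cases "b = c")
        (simp_all add: mat_nth swap_mat_def)
  qed
  then show ?thesis unfolding R_hat_def by (simp add: vec_eq_iff)
qed

text \<open>The triple sum acts on a pair of moments as (P - 1) / (x - y), where P exchanges x and
  y; the other terms of \<open>R_hat\<close> are the identity and (\<gamma>/s) P.\<close>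

lemma vtensor_moment_R_hat:
  fixes x y :: complex
  assumes "x \<noteq> y"
  shows "vtensor (moment x) (moment y) v* R_hat \<gamma> s
    = (1 - \<gamma> / (x - y)) *s vtensor (moment x) (moment y)
      + (\<gamma> / s + \<gamma> / (x - y)) *s (vtensor (moment y) (moment x) :: complex^('n::{finite,linorder} \<times> 'n))"
proof -
  let ?n = "CARD('n)"
  let ?S = "(\<Sum>i=1..?n. \<Sum>k=1..i-1. \<Sum>j=1..i-k.
      munit_nat (i-k) i \<otimes> munit_nat (j+k-1) j - munit_nat (j+k-1) j \<otimes> munit_nat (i-k) i) :: 'n op2"
  \<comment> \<open>The contribution of the first kind of tensor product to the entry at positions p
    and q. The second kind gives the same expression with x, y and p, q exchanged.\<close>
  let ?T = "\<lambda>x y p q. \<Sum>i=1..?n. \<Sum>k=1..i-1. \<Sum>j=1..i-k.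
     (if p = i then moment_nat ?n x (i-k) else 0) * (if q = j then moment_nat ?n y (j+k-1) else 0)"
  \<comment> \<open>Only i = p and j = q survive, and the range condition j \<le> i - k becomes k
    \<le> p - q.\<close>
  have T: "?T x y p q = (\<Sum>k=1..p-q. moment_nat ?n x (p - k) * moment_nat ?n y (q + k - 1))"
    if "1 \<le> p" "p \<le> ?n" "1 \<le> q" for x y p q
  proof -
    have "?T x y p q = (\<Sum>i=1..?n. if i = p then \<Sum>k=1..p-1. \<Sum>j=1..p-k.
       moment_nat ?n x (p-k) * (if q = j then moment_nat ?n y (j+k-1) else 0) else 0)"
      by (rule sum.cong) auto
    also have "\<dots> = (\<Sum>k=1..p-1. \<Sum>j=1..p-k.
       moment_nat ?n x (p-k) * (if j = q then moment_nat ?n y (j+k-1) else 0))"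
      using that by (simp add: eq_commute[of q])
    also have "\<dots> = (\<Sum>k=1..p-1. if q \<le> p-k then moment_nat ?n x (p-k) * moment_nat ?n y (q+k-1) else 0)"
      using that by (intro sum.cong refl) (simp add: sum_distrib_left[symmetric])
    also have "\<dots> = (\<Sum>k=1..p-q. moment_nat ?n x (p - k) * moment_nat ?n y (q + k - 1))"
      using that by (intro sum.mono_neutral_cong_right) auto
    finally show ?thesis .
  qed
  have S: "(vtensor (moment x) (moment y) v* ?S) $ (c, d)
     = ?T x y (pos c) (pos d) - ?T y x (pos d) (pos c)" for c d
    by (simp add: vector_matrix_sum vector_matrix_mult_diff_rdistrib vtensor_tensor moment_munit_nat
        sum_subtractf[symmetric] del: mult_zero_left mult_zero_right)
       (intro sum.cong refl; subst (1 2 3 4) moment_munit_nat; auto)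
  \<comment> \<open>At most one of the two sums is nonempty: the first if q < p, the second if p <
    q. Each case is a divided difference of monomials.\<close>
  have dd: "(x - y) * (?T x y p q - ?T y x q p)
       = moment_nat ?n y p * moment_nat ?n x q - moment_nat ?n x p * moment_nat ?n y q"
    if "1 \<le> p" "p \<le> ?n" "1 \<le> q" "q \<le> ?n" for p q
  proof -
    have T1: "?T x y p q = (\<Sum>k=1..p-q. moment_nat ?n x (p - k) * moment_nat ?n y (q + k - 1))"
      using that by (intro T) auto
    have T2: "?T y x q p = (\<Sum>k=1..q-p. moment_nat ?n y (q - k) * moment_nat ?n x (p + k - 1))"
      using that by (intro T) auto
    show ?thesis
    proof (cases "q \<le> p")
      case True
      then show ?thesis unfolding T1 T2
        using that moment_nat_divided_difference[of q p ?n x y] by (simp add: mult.commute)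
    next
      case False
      then show ?thesis unfolding T1 T2
        using that moment_nat_divided_difference[of p q ?n y x] by (simp add: algebra_simps)
    qed
  qed
  have "(vtensor (moment x) (moment y) v* R_hat \<gamma> s) $ (c, d)
     = ((1 - \<gamma> / (x - y)) *s vtensor (moment x) (moment y)
      + (\<gamma> / s + \<gamma> / (x - y)) *s vtensor (moment y) (moment x)) $ (c, d)" for c d :: 'n
  proof -
    let ?m = "\<lambda>x c. moment_nat ?n x (pos (c :: 'n))"
    have "?T x y (pos c) (pos d) - ?T y x (pos d) (pos c) = (?m y c * ?m x d - ?m x c * ?m y d) / (x - y)"
    proof (rule eq_divide_imp)
      show "x - y \<noteq> 0" using assms by simp
    qed (subst mult.commute, rule dd[OF pos_ge pos_le pos_ge pos_le])
    then have "(vtensor (moment x) (moment y) v* R_hat \<gamma> s) $ (c, d)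
       = ?m x c * ?m y d + \<gamma> / s * (?m y c * ?m x d) + \<gamma> * ((?m y c * ?m x d - ?m x c * ?m y d) / (x - y))"
      unfolding R_hat_eq vector_matrix_mult_add_rdistrib vector_matrix_cscale vtensor_swap_mat
        vector_add_component vector_smult_component S
      by (simp add: moment_def)
    then show ?thesis by (simp add: moment_def algebra_simps diff_divide_distrib)
  qed
  then show ?thesis by (simp add: vec_eq_iff)
qed

section \<open>Dynamical shifts and threefold tensor products\<close>

lemma tensor_row: "(M \<otimes> N) $ (i, j) = vtensor (M $ i) (N $ j)"
  by (simp add: vec_eq_iff)

lemma vandermonde_row [simp]: "vandermonde lam $ i = moment (lam $ i)"
  by (simp add: vandermonde_def)

lemma axis_v_mult: "axis i 1 v* M = M $ i" for M :: "complex^'m::finite^'k::finite"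
  by (simp add: vec_eq_iff vector_matrix_mult_def axis_def if_distrib[of "\<lambda>x. x * _"] cong: if_cong)

text \<open>In a row whose index in the shifting space is \<open>h\<close>, only the projection onto
  \<open>h\<close> survives. Row by row, a dynamical shift is therefore plain evaluation at a
  shifted point.\<close>

lemma dshift_row:
  fixes emb :: "'n::finite op1 \<Rightarrow> complex^'k::finite^'k"
  assumes "\<And>j (X :: complex^'k^'k). (emb (munit j j) ** X) $ r = (if h = j then X $ r else 0)"
  shows "dshift \<gamma> emb M lam $ r = M (lam + axis h \<gamma>) $ r"
  by (simp add: dshift_def assms if_distrib[of "\<lambda>x. x $ _"] cong: if_cong)

lemma dshift_row_axis:
  assumes "\<And>j. emb (munit j j) $ r = (if h = j then axis r 1 else 0)"
  shows "dshift \<gamma> emb M lam $ r = M (lam + axis h \<gamma>) $ r"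
  by (rule dshift_row) (simp add: row_matrix_mult assms axis_v_mult)

lemma dshift_fst_leg_row:
  "dshift \<gamma> fst_leg M lam $ (a, b) = M (lam + axis a \<gamma>) $ (a, b)"
  by (rule dshift_row_axis) (auto simp: vec_eq_iff munit_nth mat_nth axis_def)

lemma dshift_snd_leg_row:
  "dshift \<gamma> snd_leg M lam $ (a, b) = M (lam + axis b \<gamma>) $ (a, b)"
  by (rule dshift_row_axis) (auto simp: vec_eq_iff munit_nth mat_nth axis_def)

section \<open>Operators on three tensor factors\<close>

lemma sum_UNIV_triple: "(\<Sum>p\<in>UNIV. f p) = (\<Sum>a\<in>UNIV. \<Sum>b\<in>UNIV. \<Sum>c\<in>UNIV. f (a, b, c))"
  by (simp add: sum_UNIV_pair)

lemma leg_nth: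
  "leg1 M $ (a1, a2, a3) $ (c1, c2, c3) = (if a2 = c2 \<and> a3 = c3 then M $ a1 $ c1 else 0)"
  "leg2 M $ (a1, a2, a3) $ (c1, c2, c3) = (if a1 = c1 \<and> a3 = c3 then M $ a2 $ c2 else 0)"
  "leg3 M $ (a1, a2, a3) $ (c1, c2, c3) = (if a1 = c1 \<and> a2 = c2 then M $ a3 $ c3 else 0)"
  "leg12 N $ (a1, a2, a3) $ (c1, c2, c3) = (if a3 = c3 then N $ (a1, a2) $ (c1, c2) else 0)"
  "leg13 N $ (a1, a2, a3) $ (c1, c2, c3) = (if a2 = c2 then N $ (a1, a3) $ (c1, c3) else 0)"
  "leg23 N $ (a1, a2, a3) $ (c1, c2, c3) = (if a1 = c1 then N $ (a2, a3) $ (c2, c3) else 0)"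
  by (simp_all add: leg1_def leg2_def leg3_def leg12_def leg13_def leg23_def)

lemma dshift_leg_row:
  "dshift \<gamma> leg1 M lam $ (a, b, c) = M (lam + axis a \<gamma>) $ (a, b, c)"
  "dshift \<gamma> leg2 M lam $ (a, b, c) = M (lam + axis b \<gamma>) $ (a, b, c)"
  "dshift \<gamma> leg3 M lam $ (a, b, c) = M (lam + axis c \<gamma>) $ (a, b, c)"
  by (rule dshift_row_axis; auto simp: vec_eq_iff munit_nth axis_def leg_nth)+

lemma sum_if_const: "(\<Sum>x\<in>A. if P then f x else 0) = (if P then \<Sum>x\<in>A. f x else (0 :: complex))"
  by simp

lemma if_mult_delta:
  "(if P then x else 0) * y = (if P then x * y else (0 :: complex))"
  "y * (if P then x else 0) = (if P then y * x else (0 :: complex))"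
  by simp_all

definition tensor3 :: "'n::finite op1 \<Rightarrow> 'n op1 \<Rightarrow> 'n op1 \<Rightarrow> 'n op3" where
  "tensor3 L M N = (\<chi> r c. case (r, c) of ((r1, r2, r3), (c1, c2, c3)) \<Rightarrow>
     L $ r1 $ c1 * M $ r2 $ c2 * N $ r3 $ c3)"

lemma tensor3_nth [simp]:
  "tensor3 L M N $ (a1, a2, a3) $ (c1, c2, c3) = L $ a1 $ c1 * M $ a2 $ c2 * N $ a3 $ c3"
  by (simp add: tensor3_def)

lemma sum_product3:
  "(\<Sum>a\<in>A. f a) * (\<Sum>b\<in>B. g b) * (\<Sum>c\<in>C. h c) = (\<Sum>a\<in>A. \<Sum>b\<in>B. \<Sum>c\<in>C. f a * g b * (h c :: complex))"
  by (simp add: sum_distrib_left sum_distrib_right) 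
     (simp add: sum_distrib_left[symmetric] sum_distrib_right[symmetric])

lemma tensor3_mult: "tensor3 L M N ** tensor3 L' M' N' = tensor3 (L ** L') (M ** M') (N ** N')"
proof -
  have "(tensor3 L M N ** tensor3 L' M' N') $ (a1, a2, a3) $ (c1, c2, c3)
     = tensor3 (L ** L') (M ** M') (N ** N') $ (a1, a2, a3) $ (c1, c2, c3)" for a1 a2 a3 c1 c2 c3
    by (simp only: matrix_matrix_mult_def sum_UNIV_triple tensor3_nth vec_lambda_beta sum_product3)
      (simp only: mult_ac)
  then show ?thesis by (simp add: vec_eq_iff)
qed

lemma tensor3_mat_1 [simp]: "tensor3 (mat 1) (mat 1) (mat 1) = mat 1"
  by (auto simp: vec_eq_iff mat_nth)

text \<open>On the factor untouched by the leg both sides act by \<open>b\<close>, so the relation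
  lifts from two factors to three. This carries equations from \<open>R_hat\<close> over to
  \<open>A_hat\<close>.\<close>

lemma intertwine_legs:
  assumes "R ** (b \<otimes> b) = (b \<otimes> b) ** A"
  shows "leg12 R ** tensor3 b b b = tensor3 b b b ** leg12 A"
    and "leg13 R ** tensor3 b b b = tensor3 b b b ** leg13 A"
    and "leg23 R ** tensor3 b b b = tensor3 b b b ** leg23 A"
proof -
  have eq: "(\<Sum>x\<in>UNIV. \<Sum>y\<in>UNIV. R $ (p, q) $ (x, y) * (b $ x $ r * b $ y $ s))
     = (\<Sum>x\<in>UNIV. \<Sum>y\<in>UNIV. b $ p $ x * b $ q $ y * A $ (x, y) $ (r, s))" for p q r s
    using arg_cong[OF assms, of "\<lambda>M. M $ (p, q) $ (r, s)"]
    by (simp add: matrix_matrix_mult_def sum_UNIV_pair)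
  note simps = matrix_matrix_mult_def sum_UNIV_triple leg_nth if_mult_delta sum_if_const
    sum_distrib_left sum_distrib_right mult_ac
  have "(leg12 R ** tensor3 b b b) $ (a1, a2, a3) $ (c1, c2, c3)
     = (tensor3 b b b ** leg12 A) $ (a1, a2, a3) $ (c1, c2, c3)" for a1 a2 a3 c1 c2 c3
  proof -
    have "(leg12 R ** tensor3 b b b) $ (a1, a2, a3) $ (c1, c2, c3)
      = (\<Sum>x\<in>UNIV. \<Sum>y\<in>UNIV. R $ (a1, a2) $ (x, y) * (b $ x $ c1 * b $ y $ c2)) * b $ a3 $ c3"
      by (simp add: simps)
    also have "\<dots> = (tensor3 b b b ** leg12 A) $ (a1, a2, a3) $ (c1, c2, c3)"
      unfolding eq
      by (simp add: simps)
    finally show ?thesis .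
  qed
  then show "leg12 R ** tensor3 b b b = tensor3 b b b ** leg12 A" by (simp add: vec_eq_iff)
  have "(leg13 R ** tensor3 b b b) $ (a1, a2, a3) $ (c1, c2, c3)
     = (tensor3 b b b ** leg13 A) $ (a1, a2, a3) $ (c1, c2, c3)" for a1 a2 a3 c1 c2 c3
  proof -
    have "(leg13 R ** tensor3 b b b) $ (a1, a2, a3) $ (c1, c2, c3)
      = (\<Sum>x\<in>UNIV. \<Sum>y\<in>UNIV. R $ (a1, a3) $ (x, y) * (b $ x $ c1 * b $ y $ c3)) * b $ a2 $ c2"
      by (simp add: simps)
    also have "\<dots> = (tensor3 b b b ** leg13 A) $ (a1, a2, a3) $ (c1, c2, c3)"
      unfolding eq
      by (simp add: simps)
    finally show ?thesis .
  qed
  then show "leg13 R ** tensor3 b b b = tensor3 b b b ** leg13 A" by (simp add: vec_eq_iff)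
  have "(leg23 R ** tensor3 b b b) $ (a1, a2, a3) $ (c1, c2, c3)
     = (tensor3 b b b ** leg23 A) $ (a1, a2, a3) $ (c1, c2, c3)" for a1 a2 a3 c1 c2 c3
  proof -
    have "(leg23 R ** tensor3 b b b) $ (a1, a2, a3) $ (c1, c2, c3)
      = (\<Sum>x\<in>UNIV. \<Sum>y\<in>UNIV. R $ (a2, a3) $ (x, y) * (b $ x $ c2 * b $ y $ c3)) * b $ a1 $ c1"
      by (simp add: simps)
    also have "\<dots> = (tensor3 b b b ** leg23 A) $ (a1, a2, a3) $ (c1, c2, c3)"
      unfolding eq
      by (simp add: simps)
    finally show ?thesis .
  qed
  then show "leg23 R ** tensor3 b b b = tensor3 b b b ** leg23 A" by (simp add: vec_eq_iff)
qed

section \<open>Yang-Baxter equations of \<open>R_hat\<close> and \<open>A_hat\<close>\<close>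

definition vtensor3 :: "complex^'n::finite \<Rightarrow> complex^'n \<Rightarrow> complex^'n \<Rightarrow> complex^('n \<times> 'n \<times> 'n)" where
  "vtensor3 u v w = (\<chi> r. u $ fst r * v $ fst (snd r) * w $ snd (snd r))"

lemma vtensor3_nth [simp]: "vtensor3 u v w $ (a, b, c) = u $ a * v $ b * w $ c"
  by (simp add: vtensor3_def)

lemma vtensor3_leg:
  "(vtensor3 u v w v* leg12 M) $ (a, b, c) = (vtensor u v v* M) $ (a, b) * w $ c"
  "(vtensor3 u v w v* leg13 M) $ (a, b, c) = (vtensor u w v* M) $ (a, c) * v $ b"
  "(vtensor3 u v w v* leg23 M) $ (a, b, c) = u $ a * (vtensor v w v* M) $ (b, c)"
  by (simp_all add: vector_matrix_mult_def sum_UNIV_triple sum_UNIV_pair leg_nth if_mult_delta sum_if_const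
      sum_distrib_left sum_distrib_right mult_ac)

lemma vtensor3_moment_R_hat:
  fixes x y z :: complex
  defines "m \<equiv> \<lambda>x y z. vtensor3 (moment x) (moment y) (moment z :: complex^'n::{finite,linorder})"
  shows "x \<noteq> y \<Longrightarrow> m x y z v* leg12 (R_hat \<gamma> s)
       = (1 - \<gamma> / (x - y)) *s m x y z + (\<gamma> / s + \<gamma> / (x - y)) *s m y x z"
    and "x \<noteq> z \<Longrightarrow> m x y z v* leg13 (R_hat \<gamma> s)
       = (1 - \<gamma> / (x - z)) *s m x y z + (\<gamma> / s + \<gamma> / (x - z)) *s m z y x"
    and "y \<noteq> z \<Longrightarrow> m x y z v* leg23 (R_hat \<gamma> s)
       = (1 - \<gamma> / (y - z)) *s m x y z + (\<gamma> / s + \<gamma> / (y - z)) *s m x z y"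
  by (simp_all add: vec_eq_iff m_def vtensor3_leg vtensor_moment_R_hat algebra_simps)

lemma matrix_left_cancel:
  assumes "W ** T = mat 1" "T ** X = T ** Y"
  shows "X = Y"
proof -
  have "W ** (T ** X) = W ** (T ** Y)" by (simp add: assms(2))
  then show ?thesis by (simp add: matrix_mul_assoc assms(1))
qed

text \<open>The moment tensors over a grid of nodes are the rows of a tensor product of Vandermonde
  matrices. This matrix is invertible, so it can be cancelled.\<close>

lemma moment_tensor_separating:
  fixes L R :: "'n::{finite,linorder} op3"
  assumes "\<And>x y z. x \<noteq> y \<Longrightarrow> y \<noteq> z \<Longrightarrow> x \<noteq> z \<Longrightarrow>
    vtensor3 (moment x) (moment y) (moment z) v* L = vtensor3 (moment x) (moment y) (moment z) v* R"
  shows "L = R"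
proof -
  \<comment> \<open>Three disjoint sets of nodes, one for each tensor factor, so that no two points coincide.\<close>
  define nodes :: "nat \<Rightarrow> (complex, 'n) vec" where "nodes t = (\<chi> i. of_nat (3 * pos i + t))" for t
  have ne: "nodes t $ i \<noteq> nodes t' $ j" if "t < 3" "t' < 3" "t \<noteq> t'" for t t' i j
  proof -
    have "3 * pos i + t \<noteq> 3 * pos j + t'" using that by presburger
    then show ?thesis unfolding nodes_def by (simp only: vec_lambda_beta of_nat_eq_iff not_False_eq_True)
  qed
  \<comment> \<open>At level 0, \<open>nonres\<close> is pairwise distinctness of the nodes.\<close>
  have nr: "nonres 0 0 (nodes t)" for t by (simp add: nonres_def nodes_def)
  define W where "W = tensor3 (vandermonde (nodes 0)) (vandermonde (nodes 1)) (vandermonde (nodes 2))"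
  define B where "B = tensor3 (b_hat (nodes 0)) (b_hat (nodes 1)) (b_hat (nodes 2))"
  have BW: "B ** W = mat 1"
    unfolding B_def W_def tensor3_mult vandermonde_b_hat(2)[OF nr] by simp
  have "(W ** L) $ (i, j, k) = (W ** R) $ (i, j, k)" for i j k
  proof -
    have "W $ (i, j, k) = vtensor3 (moment (nodes 0 $ i)) (moment (nodes 1 $ j)) (moment (nodes 2 $ k))"
      by (simp add: vec_eq_iff W_def)
    then show ?thesis by (simp add: row_matrix_mult assms ne)
  qed
  then have "W ** L = W ** R" by (simp add: vec_eq_iff)
  then show ?thesis by (rule matrix_left_cancel[OF BW])
qed

lemma R_hat_yang_baxter:
  fixes s t :: complex
  assumes "s \<noteq> 0" "t \<noteq> 0" "s + t \<noteq> 0"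
  shows "leg12 (R_hat \<gamma> s :: 'n::{finite,linorder} op2) ** leg13 (R_hat \<gamma> (s + t)) ** leg23 (R_hat \<gamma> t)
       = leg23 (R_hat \<gamma> t) ** leg13 (R_hat \<gamma> (s + t)) ** leg12 (R_hat \<gamma> s)"
proof (rule moment_tensor_separating)
  fix x y z :: complex
  assume ne: "x \<noteq> y" "y \<noteq> z" "x \<noteq> z"
  \<comment> \<open>For fixed \<open>N\<close> and column \<open>c\<close>, a function of three
    points. Multiplying \<open>N\<close> on the left by a leg of \<open>R_hat\<close> applies the
    corresponding \<open>ybe_op\<close> to this function.\<close>
  define g where "g N c x y z = (vtensor3 (moment x) (moment y) (moment z) v* N) $ c"
    for N :: "'n op3" and c x y z
  have g: "x \<noteq> y \<Longrightarrow> g (leg12 (R_hat \<gamma> s) ** N) c x y z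
      = (1 - \<gamma> / (x - y)) * g N c x y z + (\<gamma> / s + \<gamma> / (x - y)) * g N c y x z"
    "x \<noteq> z \<Longrightarrow> g (leg13 (R_hat \<gamma> s) ** N) c x y z
      = (1 - \<gamma> / (x - z)) * g N c x y z + (\<gamma> / s + \<gamma> / (x - z)) * g N c z y x"
    "y \<noteq> z \<Longrightarrow> g (leg23 (R_hat \<gamma> s) ** N) c x y z
      = (1 - \<gamma> / (y - z)) * g N c x y z + (\<gamma> / s + \<gamma> / (y - z)) * g N c x z y" for N c x y z s
    by (simp_all only: g_def vector_matrix_mul_assoc[symmetric] vtensor3_moment_R_hat
        vector_matrix_left_distrib scalar_vector_matrix_assoc vector_add_component vector_smult_component
        not_False_eq_True)
  \<comment> \<open>The trailing \<open>mat 1\<close> lets the rules \<open>g\<close> unfold all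
    three factors, leaving the braid identity for \<open>g (mat 1) c\<close>.\<close>
  have "g (leg12 (R_hat \<gamma> s) ** (leg13 (R_hat \<gamma> (s + t)) ** (leg23 (R_hat \<gamma> t) ** mat 1))) c x y z
    = g (leg23 (R_hat \<gamma> t) ** (leg13 (R_hat \<gamma> (s + t)) ** (leg12 (R_hat \<gamma> s) ** mat 1))) c x y z" for c
    using ybe_op_braid[OF assms, where x = "\<lambda>x. x" and i = x and j = y and k = z and \<gamma> = \<gamma> and f = "g (mat 1) c"] ne
    by (simp only: g ne ne[symmetric] ybe_op12_def ybe_op13_def ybe_op23_def not_False_eq_True)
  from this[unfolded g_def] show "vtensor3 (moment x) (moment y) (moment z) v* (leg12 (R_hat \<gamma> s :: 'n op2) ** leg13 (R_hat \<gamma> (s + t)) ** leg23 (R_hat \<gamma> t))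
    = vtensor3 (moment x) (moment y) (moment z) v* (leg23 (R_hat \<gamma> t) ** leg13 (R_hat \<gamma> (s + t)) ** leg12 (R_hat \<gamma> s))"
    unfolding vec_eq_iff matrix_mul_assoc matrix_mul_rid by blast
qed

section \<open>Conjugating \<open>R_hat\<close> into \<open>A_hat\<close>\<close>

lemma lagrange_nth_factor:
  assumes "c \<noteq> i"
  shows "lagrange lam y $ c
    = (y - lam $ i) * ((\<Prod>k\<in>UNIV-{i,c}. y - lam$k) / (\<Prod>l\<in>UNIV-{c}. lam$c - lam$l))"
proof -
  have "(\<Prod>k\<in>UNIV-{c}. y - lam$k) = (y - lam$i) * (\<Prod>k\<in>UNIV-{c}-{i}. y - lam$k)"
    using assms by (intro prod.remove) auto
  moreover have "UNIV-{c}-{i} = UNIV-{i,c}" by auto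
  ultimately show ?thesis by (simp add: lagrange_def prod_dividef)
qed

text \<open>At distinct nodes the formula for \<open>R_hat\<close> applies, and interpolation turns
  the moments into unit vectors. For i = j it has a pole, so the row is obtained as y tends to the
  node; the divided difference then becomes the derivative \<open>diag_weight\<close>.\<close>

lemma vtensor_moment_R_hat_b_hat:
  fixes lam :: "complex^'n::{finite,linorder}"
  assumes "nonres \<gamma> 0 lam"
  shows "vtensor (moment (lam $ i)) (moment (lam $ j)) v* (R_hat \<gamma> s ** (b_hat lam \<otimes> b_hat lam))
    = A_hat \<gamma> s lam $ (i, j)"
proof -
  define F where "F x y = vtensor (moment x) (moment y) v* (R_hat \<gamma> s ** (b_hat lam \<otimes> b_hat lam))" for x y
  have F: "F x y $ (c, d) = (1 - \<gamma> / (x - y)) * (lagrange lam x $ c * lagrange lam y $ d)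
      + (\<gamma> / s + \<gamma> / (x - y)) * (lagrange lam y $ c * lagrange lam x $ d)" if "x \<noteq> y" for x y c d
    using that by (simp add: F_def vector_matrix_mul_assoc[symmetric] vtensor_moment_R_hat
        vector_matrix_left_distrib scalar_vector_matrix_assoc vtensor_tensor moment_b_hat algebra_simps)
  have "F (lam $ i) (lam $ j) $ (c, d) = A_hat \<gamma> s lam $ (i, j) $ (c, d)" for c d
  proof (cases "i = j")
    case False
    then have "lam $ i \<noteq> lam $ j" using assms by (auto simp: nonres_def)
    then show ?thesis
      unfolding F[OF \<open>lam $ i \<noteq> lam $ j\<close>] lagrange_node[OF assms] A_hat_nth axis_def
      using False by (cases "c = i"; cases "c = j"; cases "d = i"; cases "d = j") simp_all
  next
    case True
    \<comment> \<open>The formula for \<open>F\<close> is singular at \<open>y = x\<close>; \<open>G\<close> is its continuous extension.\<close>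
    let ?x = "lam $ i"
    \<comment> \<open>\<open>?e c\<close> is the value of the c-th Lagrange polynomial at the node
      lam_i.\<close>
    let ?e = "\<lambda>c. if c = i then 1 else (0 :: complex)"
    define Q where "Q c y = (\<Prod>k\<in>UNIV-{i,c}. y - lam$k) / (\<Prod>l\<in>UNIV-{c}. lam$c - lam$l)" for c y
    define G where "G y = ?e c * lagrange lam y $ d + \<gamma> / s * (lagrange lam y $ c * ?e d)
       + \<gamma> * ((if d = i then 0 else ?e c * Q d y) - (if c = i then 0 else ?e d * Q c y))" for y
    have "F ?x y $ (c, d) = G y" if "y \<noteq> ?x" for y
    proof -
      have L: "lagrange lam y $ a = (y - ?x) * Q a y" if "a \<noteq> i" for a
        using lagrange_nth_factor[OF that] by (simp add: Q_def)
      define w where "w = \<gamma> / (?x - y)"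
      have "F ?x y $ (c, d) = (1 - w) * (?e c * lagrange lam y $ d)
          + (\<gamma> / s + w) * (lagrange lam y $ c * ?e d)"
        unfolding w_def using that by (simp add: F lagrange_node[OF assms] axis_def eq_commute[of i])
      \<comment> \<open>The pole of \<open>w\<close> at the node cancels against the zero there of a
        Lagrange polynomial with another index.\<close>
      moreover have "w * ((y - ?x) * q) = - (\<gamma> * q)" for q
        using that by (simp add: w_def field_simps)
      ultimately show ?thesis
        by (cases "c = i"; cases "d = i") (simp_all add: G_def L left_diff_distrib[of _ w] distrib_right[of _ w])
    qed
    then have ev: "\<forall>\<^sub>F y in at ?x. F ?x y $ (c, d) = G y"
      by (auto simp: eventually_at_filter)
    \<comment> \<open>By its definition, without the divided formula, \<open>F\<close> is a
      polynomial in y and hence continuous at the node.\<close>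
    have limF: "((\<lambda>y. F ?x y $ (c, d)) \<longlongrightarrow> F ?x ?x $ (c, d)) (at ?x)"
      unfolding F_def vector_matrix_mult_def vec_lambda_beta sum_UNIV_pair vtensor_nth moment_def moment_nat_def
      by (intro tendsto_intros)
    have limG: "(G \<longlongrightarrow> G ?x) (at ?x)"
    proof -
      have cont: "((\<lambda>y. (\<Prod>k\<in>S. y - lam$k) / K) \<longlongrightarrow> (\<Prod>k\<in>S. ?x - lam$k) / K) (at ?x)" for S K
        unfolding divide_inverse
        by (rule tendsto_mult, rule tendsto_prod, intro tendsto_intros, rule tendsto_const)
      have lim: "((\<lambda>y. lagrange lam y $ a) \<longlongrightarrow> lagrange lam ?x $ a) (at ?x)" "(Q a \<longlongrightarrow> Q a ?x) (at ?x)" for a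
        unfolding lagrange_def vec_lambda_beta prod_dividef Q_def by (rule cont)+
      show ?thesis unfolding G_def
        by (cases "c = i"; cases "d = i"; simp only: simp_thms if_True if_False;
            (rule tendsto_add tendsto_diff tendsto_mult tendsto_const lim)+)
    qed
    have "F ?x ?x $ (c, d) = G ?x"
      by (rule LIM_unique[OF limF tendsto_cong[OF ev, THEN iffD2, OF limG]])
    also have "\<dots> = A_hat \<gamma> s lam $ (i, i) $ (c, d)"
      unfolding G_def lagrange_node[OF assms] A_hat_nth Q_def diag_weight_def[symmetric]
      by (cases "c = i"; cases "d = i") (simp_all add: axis_def eq_commute[of i])
    finally show ?thesis using True by simp
  qed
  then show ?thesis by (simp add: F_def vec_eq_iff)
qed

lemma A_hat_conj:
  fixes lam :: "complex^'n::{finite,linorder}"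
  assumes "nonres \<gamma> 0 lam"
  shows "A_hat \<gamma> s lam
    = (vandermonde lam \<otimes> vandermonde lam) ** R_hat \<gamma> s ** (b_hat lam \<otimes> b_hat lam)"
proof -
  have "A_hat \<gamma> s lam $ (i, j)
    = ((vandermonde lam \<otimes> vandermonde lam) ** (R_hat \<gamma> s ** (b_hat lam \<otimes> b_hat lam))) $ (i, j)" for i j
    by (simp add: row_matrix_mult tensor_row vtensor_moment_R_hat_b_hat[OF assms])
  then show ?thesis by (simp add: vec_eq_iff matrix_mul_assoc)
qed

lemma intertwine_mult3:
  assumes "A ** T = T ** A'" "B ** T = T ** B'" "C ** T = T ** C'"
  shows "A ** B ** C ** T = T ** (A' ** B' ** C')"
proof -
  have "A ** B ** C ** T = A ** B ** (T ** C')" by (simp add: matrix_mul_assoc[symmetric] assms(3))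
  also have "\<dots> = A ** (B ** T) ** C'" by (simp add: matrix_mul_assoc)
  also have "\<dots> = A ** T ** B' ** C'" by (simp add: assms(2) matrix_mul_assoc)
  also have "\<dots> = T ** (A' ** B' ** C')" by (simp add: assms(1) matrix_mul_assoc)
  finally show ?thesis .
qed

text \<open>All three legs are conjugated by the same invertible \<open>tensor3\<close> of
  \<open>b_hat lam\<close>, so the equation of \<open>R_hat\<close> carries over.\<close>

lemma A_hat_yang_baxter:
  fixes lam :: "complex^'n::{finite,linorder}" and s t :: complex
  assumes "nonres \<gamma> 0 lam" "s \<noteq> 0" "t \<noteq> 0" "s + t \<noteq> 0"
  shows "leg12 (A_hat \<gamma> s lam) ** leg13 (A_hat \<gamma> (s + t) lam) ** leg23 (A_hat \<gamma> t lam)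
       = leg23 (A_hat \<gamma> t lam) ** leg13 (A_hat \<gamma> (s + t) lam) ** leg12 (A_hat \<gamma> s lam)"
proof -
  let ?b = "b_hat lam" and ?V = "vandermonde lam"
  let ?T = "tensor3 ?b ?b ?b"
  have "R_hat \<gamma> s ** (?b \<otimes> ?b) = (?b \<otimes> ?b) ** A_hat \<gamma> s lam" for s
    by (simp add: A_hat_conj[OF assms(1)] matrix_mul_assoc tensor_mult vandermonde_b_hat[OF assms(1)])
  note * = intertwine_legs[OF this]
  have VT: "tensor3 ?V ?V ?V ** ?T = mat 1"
    by (simp add: tensor3_mult vandermonde_b_hat[OF assms(1)])
  have "?T ** (leg12 (A_hat \<gamma> s lam) ** leg13 (A_hat \<gamma> (s + t) lam) ** leg23 (A_hat \<gamma> t lam))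
     = leg12 (R_hat \<gamma> s) ** leg13 (R_hat \<gamma> (s + t)) ** leg23 (R_hat \<gamma> t) ** ?T"
    by (rule intertwine_mult3[symmetric]) (rule *)+
  also have "\<dots> = leg23 (R_hat \<gamma> t) ** leg13 (R_hat \<gamma> (s + t)) ** leg12 (R_hat \<gamma> s) ** ?T"
    by (simp add: R_hat_yang_baxter assms)
  also have "\<dots> = ?T ** (leg23 (A_hat \<gamma> t lam) ** leg13 (A_hat \<gamma> (s + t) lam) ** leg12 (A_hat \<gamma> s lam))"
    by (rule intertwine_mult3) (rule *)+
  finally show ?thesis by (rule matrix_left_cancel[OF VT])
qed

section \<open>\<open>B_hat\<close> and \<open>D_mat\<close> in terms of \<open>b_hat\<close>\<close>

lemma p_mat_nth:
  "p_mat \<gamma> lam i $ r $ c =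
     (if r = i then
        if c = i then \<Prod>k\<in>UNIV-{i}. (lam$i - lam$k) / (lam$i - lam$k + \<gamma>)
        else - (\<gamma> / (lam$c - lam$i - \<gamma>) * (\<Prod>k\<in>UNIV-{i,c}. (lam$i - lam$k) / (lam$c - lam$k)))
      else if r = c then 1 else 0)"
proof -
  let ?q = "\<lambda>j. \<gamma> / (lam$j - lam$i - \<gamma>) * (\<Prod>k\<in>UNIV-{i,j}. (lam$i - lam$k) / (lam$j - lam$k))"
  have "p_mat \<gamma> lam i $ r $ c =
      (\<Prod>k\<in>UNIV-{i}. (lam$i - lam$k) / (lam$i - lam$k + \<gamma>)) * munit i i $ r $ c
      + ((\<Sum>j\<in>UNIV-{i}. munit j j $ r $ c) - (\<Sum>j\<in>UNIV-{i}. ?q j * munit i j $ r $ c))"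
    unfolding p_mat_def vector_add_component sum_component vector_minus_component cscale_nth sum_subtractf
    by (rule refl)
  moreover have "(\<Sum>j\<in>UNIV-{i}. munit j j $ r $ c) = (\<Sum>j\<in>UNIV-{i}. if j = c then if r = c then 1 else 0 else 0)"
    by (rule sum.cong) (auto simp: munit_nth)
  moreover have "(\<Sum>j\<in>UNIV-{i}. ?q j * munit i j $ r $ c) = (\<Sum>j\<in>UNIV-{i}. if j = c then if r = i then ?q c else 0 else 0)"
    by (rule sum.cong) (auto simp: munit_nth)
  ultimately show ?thesis
    by (cases "r = i"; cases "c = i"; cases "r = c") (simp_all add: munit_nth)
qed

text \<open>The entries on the right are the Lagrange polynomials of the shifted nodes, evaluated at
  the old ones. Only node i moves, so every other row is a unit row, and row i gives the explicit
  products.\<close>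

lemma p_mat_eq:
  fixes lam :: "complex^'n::{finite,linorder}"
  assumes "nonres \<gamma> 1 lam"
  shows "p_mat \<gamma> lam i = vandermonde lam ** b_hat (lam + axis i \<gamma>)"
proof -
  let ?mu = "lam + axis i \<gamma>"
  have nr: "nonres \<gamma> 0 ?mu" using assms nonres_shift[of \<gamma> 0] by simp
  have "p_mat \<gamma> lam i $ r $ c = lagrange ?mu (lam $ r) $ c" for r c
  proof (cases "r = i")
    case False
    then have "lam $ r = ?mu $ r" by (simp add: axis_def)
    then have "lagrange ?mu (lam $ r) = axis r 1" by (simp only: lagrange_node[OF nr])
    with False show ?thesis by (auto simp: p_mat_nth axis_def)
  next
    case True
    show ?thesis
    proof (cases "c = i")
      case c: True
      have "lagrange ?mu (lam $ i) $ i = (\<Prod>k\<in>UNIV-{i}. (lam$i - lam$k) / (lam$i - lam$k + \<gamma>))"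
        unfolding lagrange_def vec_lambda_beta by (rule prod.cong) (auto simp: axis_def algebra_simps)
      with True c show ?thesis by (simp add: p_mat_nth)
    next
      case c: False
      \<comment> \<open>For c \<noteq> i the factor k = i is the only one that sees the
        shift.\<close>
      have "lagrange ?mu (lam $ i) $ c = (lam$i - ?mu$i) / (?mu$c - ?mu$i)
          * (\<Prod>k\<in>UNIV-{c}-{i}. (lam$i - ?mu$k) / (?mu$c - ?mu$k))"
        unfolding lagrange_def vec_lambda_beta using c by (intro prod.remove) auto
      also have "(\<Prod>k\<in>UNIV-{c}-{i}. (lam$i - ?mu$k) / (?mu$c - ?mu$k))
          = (\<Prod>k\<in>UNIV-{i,c}. (lam$i - lam$k) / (lam$c - lam$k))"
        using c by (intro prod.cong) (auto simp: axis_def)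
      also have "(lam$i - ?mu$i) / (?mu$c - ?mu$i) = - (\<gamma> / (lam$c - lam$i - \<gamma>))"
        using c by (simp add: axis_def algebra_simps)
      finally show ?thesis using True c by (simp add: p_mat_nth)
    qed
  qed
  then have "p_mat \<gamma> lam i $ r = (vandermonde lam ** b_hat ?mu) $ r" for r
    by (simp add: row_matrix_mult moment_b_hat vec_eq_iff)
  then show ?thesis by (simp add: vec_eq_iff)
qed

lemma B_hat_nth: "B_hat \<gamma> lam $ (a, b) $ (c, d) = (if a = c then p_mat \<gamma> lam a $ b $ d else 0)"
proof -
  have "B_hat \<gamma> lam $ (a, b) $ (c, d)
      = (\<Sum>i\<in>UNIV. if i = a then if a = c then p_mat \<gamma> lam a $ b $ d else 0 else 0)"
    unfolding B_hat_def sum_component tensor_nth by (rule sum.cong) (auto simp: munit_nth)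
  then show ?thesis by simp
qed

lemma C_hat_nth: "C_hat \<gamma> lam $ (a, b) $ (c, d) = (if b = d then p_mat \<gamma> lam b $ a $ c else 0)"
  by (simp add: C_hat_def flip_def B_hat_nth)

lemma dshift_fst_leg_snd_leg_nth:
  "dshift \<gamma> fst_leg (\<lambda>\<mu>. snd_leg (M \<mu>)) lam $ (a, b) $ (c, d)
     = (if a = c then M (lam + axis a \<gamma>) $ b $ d else 0)"
  by (simp add: dshift_fst_leg_row mat_nth)

lemma B_hat_eq:
  assumes "nonres \<gamma> 1 lam"
  shows "B_hat \<gamma> lam = snd_leg (vandermonde lam) ** dshift \<gamma> fst_leg (\<lambda>\<mu>. snd_leg (b_hat \<mu>)) lam"
proof -
  have "(snd_leg (vandermonde lam) ** dshift \<gamma> fst_leg (\<lambda>\<mu>. snd_leg (b_hat \<mu>)) lam) $ (a, b) $ (c, d)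
     = B_hat \<gamma> lam $ (a, b) $ (c, d)" for a b c d
    by (simp add: B_hat_nth p_mat_eq[OF assms] matrix_matrix_mult_def sum_UNIV_pair
        dshift_fst_leg_snd_leg_nth mat_nth if_mult_delta sum_if_const del: vandermonde_row)
  then show ?thesis by (simp add: vec_eq_iff)
qed

lemma vtensor_fst_leg: "vtensor v w v* fst_leg M = vtensor (v v* M) w"
  by (simp add: vtensor_tensor)

text \<open>The shifted matrix is diagonal in the first factor, so the column index \<open>c\<close>
  already determines the shift.\<close>

lemma vtensor_axis_dshift:
  "(vtensor v w v* dshift \<gamma> fst_leg (\<lambda>\<mu>. snd_leg (M \<mu>)) lam) $ (c, d) = v $ c * (w v* M (lam + axis c \<gamma>)) $ d"
  by (simp add: vector_matrix_mult_def sum_UNIV_pair dshift_fst_leg_snd_leg_nth if_mult_delta sum_if_const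
      sum_distrib_left mult_ac)

text \<open>Row (i, j) of the two inverse factors is a tensor of moments at two points. The formula
  for \<open>R_hat\<close> applies there, and the remaining factors interpolate, the second with
  nodes shifted according to the first index.\<close>

lemma D_mat_eq:
  fixes lam :: "complex^'n::{finite,linorder}"
  assumes nr1: "nonres \<gamma> 1 lam" and "\<gamma> \<noteq> 0"
  shows "D_mat \<gamma> s lam
    = dshift \<gamma> snd_leg (\<lambda>\<mu>. fst_leg (matrix_inv (b_hat \<mu>))) lam
      ** snd_leg (matrix_inv (b_hat lam)) ** R_hat \<gamma> s
      ** fst_leg (b_hat lam) ** dshift \<gamma> fst_leg (\<lambda>\<mu>. snd_leg (b_hat \<mu>)) lam"
    (is "_ = ?X ** ?Y ** _ ** ?Z ** ?W")
proof -
  have nr0: "nonres \<gamma> 0 lam" using nr1 nonres_mono by blast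
  have nrs: "nonres \<gamma> 0 (lam + axis k \<gamma>)" for k using nr1 nonres_shift[of \<gamma> 0] by simp
  have "(?X ** ?Y ** R_hat \<gamma> s ** ?Z ** ?W) $ (i, j) $ (c, d) = D_mat \<gamma> s lam $ (i, j) $ (c, d)" for i j c d
  proof -
    define x y where "x = (lam + axis j \<gamma>) $ i" and "y = lam $ j"
    \<comment> \<open>The shift moves \<open>x\<close> off lam_i only when i = j; then the two
      points differ by \<gamma>.\<close>
    have xy: "x \<noteq> y"
      using nr0 \<open>\<gamma> \<noteq> 0\<close> by (cases "i = j") (auto simp: x_def y_def axis_def nonres_def)
    have ly: "lagrange lam y = axis j 1" by (simp only: y_def lagrange_node[OF nr0])
    have "(?X ** ?Y) $ (i, j) = vtensor (moment x) (moment y)"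
    proof -
      have "(?X ** ?Y) $ (i, j) = (fst_leg (vandermonde (lam + axis j \<gamma>)) ** snd_leg (vandermonde lam)) $ (i, j)"
        by (simp only: row_matrix_mult dshift_snd_leg_row matrix_inv_b_hat[OF nr0] matrix_inv_b_hat[OF nrs])
      then show ?thesis by (simp add: tensor_mult tensor_row x_def y_def)
    qed
    then have "(?X ** ?Y ** R_hat \<gamma> s ** ?Z ** ?W) $ (i, j)
       = vtensor (moment x) (moment y) v* R_hat \<gamma> s v* ?Z v* ?W"
      by (simp only: row_matrix_mult[of _ "R_hat \<gamma> s"] row_matrix_mult[of _ ?Z] row_matrix_mult[of _ ?W])
    then have eq: "(?X ** ?Y ** R_hat \<gamma> s ** ?Z ** ?W) $ (i, j) $ (c, d)
       = (1 - \<gamma> / (x - y)) * (lagrange lam x $ c * lagrange (lam + axis c \<gamma>) y $ d)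
         + (\<gamma> / s + \<gamma> / (x - y)) * (lagrange lam y $ c * lagrange (lam + axis c \<gamma>) x $ d)"
      by (simp only: vtensor_moment_R_hat[OF xy] vector_matrix_left_distrib scalar_vector_matrix_assoc
          vtensor_fst_leg moment_b_hat vtensor_axis_dshift vector_add_component vector_smult_component)
    have ax: "axis p (1 :: complex) $ q = (if q = p then 1 else 0)" for p q :: 'n
      by (simp add: axis_def)
    show ?thesis
    proof (cases "i = j")
      case True
      have lx: "lagrange (lam + axis j \<gamma>) x = axis j 1"
        unfolding x_def True by (rule lagrange_node[OF nrs])
      \<comment> \<open>The value 1 removes the unexchanged term, and the exchanged one gets the
        coefficient \<gamma>/s + 1 of \<open>D_mat\<close>.\<close>
      have g: "\<gamma> / (x - y) = 1" using True \<open>\<gamma> \<noteq> 0\<close> by (simp add: x_def y_def axis_def)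
      show ?thesis unfolding eq ly D_mat_nth ax g using True
        by (cases "c = j"; cases "d = j") (simp_all add: lx ax add.commute)
    next
      case False
      \<comment> \<open>For i \<noteq> j, interpolation in the first factor forces c = i or c = j.
        The node left for the second factor is not the one moved by that shift.\<close>
      have x: "x = lam $ i" and xj: "x = (lam + axis j \<gamma>) $ i" and yi: "y = (lam + axis i \<gamma>) $ j"
        using False by (simp_all add: x_def y_def axis_def)
      have lx: "lagrange lam x = axis i 1" unfolding x by (rule lagrange_node[OF nr0])
      have lxj: "lagrange (lam + axis j \<gamma>) x = axis i 1" unfolding xj by (rule lagrange_node[OF nrs])
      have lyi: "lagrange (lam + axis i \<gamma>) y = axis j 1" unfolding yi by (rule lagrange_node[OF nrs])
      show ?thesis unfolding eq ly lx D_mat_nth ax x[symmetric] y_def[symmetric] using False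
        by (cases "c = i"; cases "c = j"; cases "d = i"; cases "d = j") (simp_all add: lxj lyi ax)
    qed
  qed
  then show ?thesis by (simp add: vec_eq_iff)
qed

section \<open>The consistency equations\<close>

text \<open>Operators diagonal in the third factor. Both legs of \<open>C_hat\<close> in its
  equation are of this kind, which splits the equation into one on two factors for each third
  index.\<close>

definition block3 :: "('n::finite \<Rightarrow> 'n op2) \<Rightarrow> 'n op3" where
  "block3 F = (\<chi> r c. case (r, c) of ((r1, r2, r3), (c1, c2, c3)) \<Rightarrow>
     if r3 = c3 then F r3 $ (r1, r2) $ (c1, c2) else 0)"

text \<open>Operators diagonal in the first two factors, as are the products of \<open>B_hat\<close>
  next to \<open>D_mat\<close>.\<close>

definition block12 :: "('n::finite \<Rightarrow> 'n \<Rightarrow> 'n op1) \<Rightarrow> 'n op3" where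
  "block12 F = (\<chi> r c. case (r, c) of ((r1, r2, r3), (c1, c2, c3)) \<Rightarrow>
     if r1 = c1 \<and> r2 = c2 then F r1 r2 $ r3 $ c3 else 0)"

lemma block_nth:
  "block3 F $ (a1, a2, a3) $ (c1, c2, c3) = (if a3 = c3 then F a3 $ (a1, a2) $ (c1, c2) else 0)"
  "block12 G $ (a1, a2, a3) $ (c1, c2, c3) = (if a1 = c1 then if a2 = c2 then G a1 a2 $ a3 $ c3 else 0 else 0)"
  by (simp_all add: block3_def block12_def)

lemma op3_eqI:
  assumes "\<And>a1 a2 a3 c1 c2 c3. M $ (a1, a2, a3) $ (c1, c2, c3) = N $ (a1, a2, a3) $ (c1, c2, c3)"
  shows "M = (N :: 'n::finite op3)"
  using assms by (simp add: vec_eq_iff)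

lemma block3_mult: "block3 F ** block3 G = block3 (\<lambda>j. F j ** G j)"
  by (rule op3_eqI)
     (simp add: block_nth matrix_matrix_mult_def sum_UNIV_triple sum_UNIV_pair if_mult_delta sum_if_const)

lemma block12_mult: "block12 F ** block12 G = block12 (\<lambda>i j. F i j ** G i j)"
  by (rule op3_eqI)
     (simp add: block_nth matrix_matrix_mult_def sum_UNIV_triple if_mult_delta sum_if_const)

lemma leg12_eq_block3: "leg12 M = block3 (\<lambda>_. M)"
  by (rule op3_eqI) (simp add: block_nth leg_nth)

lemma leg_C_hat_eq_block3:
  "leg13 (C_hat \<gamma> lam) = block3 (\<lambda>j. fst_leg (p_mat \<gamma> lam j))"
  "leg23 (C_hat \<gamma> lam) = block3 (\<lambda>j. snd_leg (p_mat \<gamma> lam j))"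
  by (rule op3_eqI, simp add: block_nth leg_nth C_hat_nth mat_nth)+

lemma dshift_leg3_leg12_eq_block3:
  "dshift \<gamma> leg3 (\<lambda>\<mu>. leg12 (M \<mu>)) lam = block3 (\<lambda>j. M (lam + axis j \<gamma>))"
  by (rule op3_eqI) (simp add: block_nth leg_nth dshift_leg_row)

text \<open>\<open>p_mat\<close> is the transition between the interpolation bases at lam and at the
  shifted point. Both sides reduce to \<open>R_hat\<close> between the inverse of
  \<open>b_hat\<close> at lam and \<open>b_hat\<close> at the shifted point.\<close>

lemma A_hat_p_mat:
  fixes lam :: "complex^'n::{finite,linorder}"
  assumes "nonres \<gamma> 1 lam"
  shows "A_hat \<gamma> s lam ** fst_leg (p_mat \<gamma> lam j) ** snd_leg (p_mat \<gamma> lam j)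
    = snd_leg (p_mat \<gamma> lam j) ** fst_leg (p_mat \<gamma> lam j) ** A_hat \<gamma> s (lam + axis j \<gamma>)"
proof -
  have nr0: "nonres \<gamma> 0 lam" using assms nonres_mono by blast
  have nrs: "nonres \<gamma> 0 (lam + axis j \<gamma>)" using assms nonres_shift[of \<gamma> 0] by simp
  let ?V = "vandermonde lam" and ?b' = "b_hat (lam + axis j \<gamma>)"
  have bp: "b_hat lam ** p_mat \<gamma> lam j = ?b'"
    by (simp add: p_mat_eq[OF assms] matrix_mul_assoc vandermonde_b_hat[OF nr0])
  have pV: "p_mat \<gamma> lam j ** vandermonde (lam + axis j \<gamma>) = ?V"
    by (simp add: p_mat_eq[OF assms] matrix_mul_assoc[symmetric] vandermonde_b_hat[OF nrs])
  have "A_hat \<gamma> s lam ** fst_leg (p_mat \<gamma> lam j) ** snd_leg (p_mat \<gamma> lam j)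
      = (?V \<otimes> ?V) ** R_hat \<gamma> s ** (?b' \<otimes> ?b')"
    by (simp add: A_hat_conj[OF nr0] matrix_mul_assoc[symmetric] tensor_mult bp)
  moreover have "snd_leg (p_mat \<gamma> lam j) ** fst_leg (p_mat \<gamma> lam j) ** A_hat \<gamma> s (lam + axis j \<gamma>)
      = (?V \<otimes> ?V) ** R_hat \<gamma> s ** (?b' \<otimes> ?b')"
    by (simp add: A_hat_conj[OF nrs] matrix_mul_assoc tensor_mult pV)
  ultimately show ?thesis by simp
qed

lemma A_hat_C_hat:
  fixes lam :: "complex^'n::{finite,linorder}"
  assumes "nonres \<gamma> 1 lam"
  shows "leg12 (A_hat \<gamma> s lam) ** leg13 (C_hat \<gamma> lam) ** leg23 (C_hat \<gamma> lam)
    = leg23 (C_hat \<gamma> lam) ** leg13 (C_hat \<gamma> lam) ** dshift \<gamma> leg3 (\<lambda>\<mu>. leg12 (A_hat \<gamma> s \<mu>)) lam"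
  unfolding dshift_leg3_leg12_eq_block3
  unfolding leg_C_hat_eq_block3 leg12_eq_block3 block3_mult A_hat_p_mat[OF assms]
  by (rule refl)

section \<open>The relation between \<open>D_mat\<close> and \<open>B_hat\<close>\<close>

lemma leg_B_hat_eq_block12:
  "leg13 (B_hat \<gamma> lam) = block12 (\<lambda>i j. p_mat \<gamma> lam i)"
  "leg23 (B_hat \<gamma> lam) = block12 (\<lambda>i j. p_mat \<gamma> lam j)"
  "dshift \<gamma> leg1 (\<lambda>\<mu>. leg23 (B_hat \<gamma> \<mu>)) lam = block12 (\<lambda>i j. p_mat \<gamma> (lam + axis i \<gamma>) j)"
  "dshift \<gamma> leg2 (\<lambda>\<mu>. leg13 (B_hat \<gamma> \<mu>)) lam = block12 (\<lambda>i j. p_mat \<gamma> (lam + axis j \<gamma>) i)"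
  by (rule op3_eqI, simp add: block_nth leg_nth B_hat_nth dshift_leg_row)+

text \<open>The intermediate \<open>b_hat\<close> and its inverse cancel. What remains depends only
  on the sum of the two shifts, so it is symmetric in i and j.\<close>

lemma p_mat_mult_p_mat_shift:
  fixes lam :: "complex^'n::{finite,linorder}"
  assumes "nonres \<gamma> 2 lam"
  shows "p_mat \<gamma> lam i ** p_mat \<gamma> (lam + axis i \<gamma>) j
    = vandermonde lam ** b_hat (lam + (axis i \<gamma> + axis j \<gamma>))"
proof -
  have nr1: "nonres \<gamma> 1 lam" using assms nonres_mono[of \<gamma> 2 lam 1] by simp
  have nrs1: "nonres \<gamma> 1 (lam + axis i \<gamma>)"
    using assms nonres_shift[of \<gamma> 1] by (simp add: numeral_2_eq_2)
  then have nrs0: "nonres \<gamma> 0 (lam + axis i \<gamma>)" using nonres_mono by blast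
  have "p_mat \<gamma> lam i ** p_mat \<gamma> (lam + axis i \<gamma>) j
    = vandermonde lam ** (b_hat (lam + axis i \<gamma>) ** vandermonde (lam + axis i \<gamma>))
        ** b_hat (lam + axis i \<gamma> + axis j \<gamma>)"
    by (simp only: p_mat_eq[OF nr1] p_mat_eq[OF nrs1] matrix_mul_assoc)
  then show ?thesis by (simp add: vandermonde_b_hat[OF nrs0] add.assoc)
qed

text \<open>The value for \<open>i = j\<close> is \<open>0\<close>, which makes the row formulas below uniform.\<close>

definition dyn_ratio :: "complex \<Rightarrow> complex^'n \<Rightarrow> 'n \<Rightarrow> 'n \<Rightarrow> complex" where
  "dyn_ratio \<gamma> lam i j = \<gamma> / (lam$i - lam$j)"

lemma leg_D_mat_row:
  fixes lam :: "complex^'n::finite"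
  shows "leg12 (D_mat \<gamma> s lam) $ (i, j, k) = (1 - dyn_ratio \<gamma> lam i j) *s axis (i, j, k) 1
     + (\<gamma> / s + dyn_ratio \<gamma> lam i j) *s axis (j, i, k) 1"
    and "leg13 (D_mat \<gamma> s lam) $ (i, j, k) = (1 - dyn_ratio \<gamma> lam i k) *s axis (i, j, k) 1
     + (\<gamma> / s + dyn_ratio \<gamma> lam i k) *s axis (k, j, i) 1"
    and "leg23 (D_mat \<gamma> s lam) $ (i, j, k) = (1 - dyn_ratio \<gamma> lam j k) *s axis (i, j, k) 1
     + (\<gamma> / s + dyn_ratio \<gamma> lam j k) *s axis (i, k, j) 1"
proof -
  have row_eqI: "v = w" if "\<And>c1 c2 c3. v $ (c1, c2, c3) = w $ (c1, c2, c3)"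
    for v w :: "(complex, 'n \<times> 'n \<times> 'n) vec"
    using that by (simp add: vec_eq_iff)
  have entry: "(if P then x * (if Q then 1 else 0) + y * (if Q' then 1 else 0) else 0)
      = x * (if Q \<and> P then 1 else 0) + y * (if Q' \<and> P then 1 else (0 :: complex))" for P Q Q' x y
    by simp
  note nth = leg_nth D_mat_nth vector_add_component vector_smult_component axis_def vec_lambda_beta entry dyn_ratio_def
  show "leg12 (D_mat \<gamma> s lam) $ (i, j, k) = (1 - dyn_ratio \<gamma> lam i j) *s axis (i, j, k) 1
     + (\<gamma> / s + dyn_ratio \<gamma> lam i j) *s axis (j, i, k) 1"
    by (rule row_eqI, unfold nth, intro arg_cong2[of _ _ _ _ "(+)"] arg_cong2[of _ _ _ _ "(*)"] refl if_cong) auto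
  show "leg13 (D_mat \<gamma> s lam) $ (i, j, k) = (1 - dyn_ratio \<gamma> lam i k) *s axis (i, j, k) 1
     + (\<gamma> / s + dyn_ratio \<gamma> lam i k) *s axis (k, j, i) 1"
    by (rule row_eqI, unfold nth, intro arg_cong2[of _ _ _ _ "(+)"] arg_cong2[of _ _ _ _ "(*)"] refl if_cong) auto
  show "leg23 (D_mat \<gamma> s lam) $ (i, j, k) = (1 - dyn_ratio \<gamma> lam j k) *s axis (i, j, k) 1
     + (\<gamma> / s + dyn_ratio \<gamma> lam j k) *s axis (i, k, j) 1"
    by (rule row_eqI, unfold nth, intro arg_cong2[of _ _ _ _ "(+)"] arg_cong2[of _ _ _ _ "(*)"] refl if_cong) auto
qed

text \<open>A nonzero entry of \<open>D_mat\<close> joins a pair of indices to itself or to the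
  exchanged pair, and \<open>F\<close> takes the same value on both.\<close>

lemma block12_symmetric_comm_D_mat:
  assumes "\<And>i j. F i j = F j i"
  shows "leg12 (D_mat \<gamma> s lam) ** block12 F = block12 F ** leg12 (D_mat \<gamma> s lam)"
proof (rule op3_eqI)
  fix a1 a2 a3 c1 c2 c3
  have "D_mat \<gamma> s lam $ (a1, a2) $ (c1, c2) * F c1 c2 $ a3 $ c3
      = D_mat \<gamma> s lam $ (a1, a2) $ (c1, c2) * F a1 a2 $ a3 $ c3"
  proof (cases "a1 = c1 \<and> a2 = c2 \<or> a1 = c2 \<and> a2 = c1")
    case True
    then have "F c1 c2 = F a1 a2" using assms[of a1 a2] by auto
    then show ?thesis by (simp only:)
  next
    case False
    then have "\<not> (a1 = c1 \<and> a2 = c2)" "\<not> (a1 = c2 \<and> a2 = c1)" by auto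
    then have "D_mat \<gamma> s lam $ (a1, a2) $ (c1, c2) = 0"
      by (simp only: D_mat_nth if_False mult_zero_right add_0_left)
    then show ?thesis by (simp only: mult_zero_left)
  qed
  then show "(leg12 (D_mat \<gamma> s lam) ** block12 F) $ (a1, a2, a3) $ (c1, c2, c3)
      = (block12 F ** leg12 (D_mat \<gamma> s lam)) $ (a1, a2, a3) $ (c1, c2, c3)"
    by (simp add: block_nth leg_nth matrix_matrix_mult_def sum_UNIV_triple if_mult_delta sum_if_const mult.commute)
qed

lemma D_mat_B_hat:
  fixes lam :: "complex^'n::{finite,linorder}"
  assumes "nonres \<gamma> 2 lam"
  shows "leg12 (D_mat \<gamma> s lam) ** leg13 (B_hat \<gamma> lam) ** dshift \<gamma> leg1 (\<lambda>\<mu>. leg23 (B_hat \<gamma> \<mu>)) lam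
    = leg23 (B_hat \<gamma> lam) ** dshift \<gamma> leg2 (\<lambda>\<mu>. leg13 (B_hat \<gamma> \<mu>)) lam ** leg12 (D_mat \<gamma> s lam)"
proof -
  let ?F = "\<lambda>i j. vandermonde lam ** b_hat (lam + (axis i \<gamma> + axis j \<gamma>))"
  have "leg13 (B_hat \<gamma> lam) ** dshift \<gamma> leg1 (\<lambda>\<mu>. leg23 (B_hat \<gamma> \<mu>)) lam = block12 ?F"
    unfolding leg_B_hat_eq_block12(3)
    unfolding leg_B_hat_eq_block12(1) block12_mult p_mat_mult_p_mat_shift[OF assms] by (rule refl)
  moreover have "leg23 (B_hat \<gamma> lam) ** dshift \<gamma> leg2 (\<lambda>\<mu>. leg13 (B_hat \<gamma> \<mu>)) lam = block12 ?F"
    unfolding leg_B_hat_eq_block12(4)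
    unfolding leg_B_hat_eq_block12(2) block12_mult p_mat_mult_p_mat_shift[OF assms]
    by (simp only: add.commute)
  moreover have "leg12 (D_mat \<gamma> s lam) ** block12 ?F = block12 ?F ** leg12 (D_mat \<gamma> s lam)"
    by (rule block12_symmetric_comm_D_mat) (simp only: add.commute)
  ultimately show ?thesis by (simp only: matrix_mul_assoc[symmetric])
qed

text \<open>The equation is read row by row. At pairwise distinct indices each shift moves a
  coordinate that the shifted ratio does not contain, so the identity is the braid identity. At
  coinciding indices the shifts do act, and \<open>rel\<close> accounts for them.\<close>

lemma D_mat_dynamical_yang_baxter:
  fixes lam :: "complex^'n::finite"
  assumes nr: "nonres \<gamma> 1 lam" and st: "s \<noteq> 0" "t \<noteq> 0" "s + t \<noteq> 0"
  shows "dshift \<gamma> leg3 (\<lambda>\<mu>. leg12 (D_mat \<gamma> s \<mu>)) lam ** leg13 (D_mat \<gamma> (s + t) lam)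
          ** dshift \<gamma> leg1 (\<lambda>\<mu>. leg23 (D_mat \<gamma> t \<mu>)) lam
        = leg23 (D_mat \<gamma> t lam) ** dshift \<gamma> leg2 (\<lambda>\<mu>. leg13 (D_mat \<gamma> (s + t) \<mu>)) lam
          ** leg12 (D_mat \<gamma> s lam)" (is "?D12 ** ?E13 ** ?D23 = ?E23 ** ?D13 ** ?E12")
proof -
  define r :: "(complex, 'n) vec \<Rightarrow> 'n \<Rightarrow> 'n \<Rightarrow> complex" where "r = dyn_ratio \<gamma>"
  define a b c where "a = \<gamma> / s" and "b = \<gamma> / t" and "c = \<gamma> / (s + t)"
  have abc: "a * b = c * (a + b)"
    using st by (simp add: a_def b_def c_def divide_simps) (simp add: algebra_simps)
  note row = row_matrix_mult vector_matrix_left_distrib scalar_vector_matrix_assoc axis_v_mult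
    vector_add_component vector_smult_component leg_D_mat_row dshift_leg_row
    r_def[symmetric] a_def[symmetric] b_def[symmetric] c_def[symmetric]
  have m12: "(?D12 ** N) $ (i, j, k) $ q = (1 - r (lam + axis k \<gamma>) i j) * N $ (i, j, k) $ q
      + (a + r (lam + axis k \<gamma>) i j) * N $ (j, i, k) $ q"
    and m13: "(?D13 ** N) $ (i, j, k) $ q = (1 - r (lam + axis j \<gamma>) i k) * N $ (i, j, k) $ q
      + (c + r (lam + axis j \<gamma>) i k) * N $ (k, j, i) $ q"
    and m23: "(?D23 ** N) $ (i, j, k) $ q = (1 - r (lam + axis i \<gamma>) j k) * N $ (i, j, k) $ q
      + (b + r (lam + axis i \<gamma>) j k) * N $ (i, k, j) $ q"
    and e12: "(?E12 ** N) $ (i, j, k) $ q = (1 - r lam i j) * N $ (i, j, k) $ q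
      + (a + r lam i j) * N $ (j, i, k) $ q"
    and e13: "(?E13 ** N) $ (i, j, k) $ q = (1 - r lam i k) * N $ (i, j, k) $ q
      + (c + r lam i k) * N $ (k, j, i) $ q"
    and e23: "(?E23 ** N) $ (i, j, k) $ q = (1 - r lam j k) * N $ (i, j, k) $ q
      + (b + r lam j k) * N $ (i, k, j) $ q" for N :: "'n op3" and i j k q
    by (simp_all only: row)
  have same: "r \<mu> i i = 0" for \<mu> i by (simp add: r_def dyn_ratio_def)
  have swap: "r \<mu> j i = - r \<mu> i j" for \<mu> i j
    unfolding r_def dyn_ratio_def by (metis minus_diff_eq minus_divide_right)
  have shift: "r (lam + axis l \<gamma>) i j = r lam i j" if "l \<noteq> i" "l \<noteq> j" for l i j
    using that by (simp add: r_def dyn_ratio_def axis_def)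
  have ne: "lam$i - lam$j \<noteq> 0" "lam$i + \<gamma> - lam$j \<noteq> 0" if "i \<noteq> j" for i j
  proof -
    have "lam$i - lam$j \<noteq> of_int k * \<gamma>" if "\<bar>k\<bar> \<le> 1" for k
      using nr \<open>i \<noteq> j\<close> that unfolding nonres_def by simp
    from this[of 0] this[of "-1"] show "lam$i - lam$j \<noteq> 0" "lam$i + \<gamma> - lam$j \<noteq> 0"
      by (auto simp: algebra_simps eq_neg_iff_add_eq_0)
  qed
  \<comment> \<open>With d = lam_i - lam_j this is \<gamma>/(d + \<gamma>) times (d +
    \<gamma>)/d.\<close>
  have rel: "r (lam + axis i \<gamma>) i j * (1 + r lam i j) = r lam i j" if "i \<noteq> j" for i j
    using ne[OF that] that by (simp add: r_def dyn_ratio_def axis_def divide_simps)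
  have "(?D12 ** (?E13 ** (?D23 ** mat 1))) $ (i, j, k) $ q
      = (?E23 ** (?D13 ** (?E12 ** mat 1))) $ (i, j, k) $ q" for i j k q
  proof -
    define f where "f i j k = (mat 1 :: 'n op3) $ (i, j, k) $ q" for i j k
    note m = m12 m13 m23 e12 e13 e23 f_def[symmetric]
    \<comment> \<open>If all indices agree, the six operators act on the row as scalars. If exactly
      two agree, one ratio and its shifts remain, related by \<open>rel\<close> for one or both
      orders of the two indices.\<close>
    consider "i = j" "j = k" | "i = j" "j \<noteq> k" | "i = k" "j \<noteq> k" | "j = k" "i \<noteq> j"
      | "i \<noteq> j" "j \<noteq> k" "i \<noteq> k" by blast
    then show ?thesis
    proof cases
      case 1
      then show ?thesis by (simp only: m same) (simp add: algebra_simps)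
    next
      case 2
      then have "i \<noteq> k" by simp
      show ?thesis unfolding m \<open>i = j\<close>[symmetric] same swap[of _ k i]
        using abc rel[OF \<open>i \<noteq> k\<close>] by algebra
    next
      case 3
      then have "i \<noteq> j" by simp
      show ?thesis unfolding m \<open>i = k\<close>[symmetric] same swap[of _ j i]
        using abc rel[OF \<open>i \<noteq> j\<close>] rel[OF \<open>i \<noteq> j\<close>[symmetric], unfolded swap[of _ j i]] by algebra
    next
      case 4
      show ?thesis unfolding m \<open>j = k\<close>[symmetric] same swap[of _ j i]
        using abc rel[OF \<open>i \<noteq> j\<close>] rel[OF \<open>i \<noteq> j\<close>[symmetric], unfolded swap[of _ j i]] by algebra
    next
      case 5
      have "lam$i \<noteq> lam$j" "lam$j \<noteq> lam$k" "lam$i \<noteq> lam$k"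
        using ne(1) 5 by auto
      from ybe_op_braid[where x = "\<lambda>i. lam $ i" and \<gamma> = \<gamma> and f = f, OF st this]
      show ?thesis
        unfolding m ybe_op12_def ybe_op13_def ybe_op23_def dyn_ratio_def[symmetric] r_def[symmetric]
          a_def[symmetric] b_def[symmetric] c_def[symmetric]
        by (simp only: shift 5 5[symmetric] not_False_eq_True)
    qed
  qed
  then show ?thesis by (simp add: vec_eq_iff matrix_mul_assoc)
qed

theorem mainTheorem5:
  fixes \<gamma> :: complex and lam :: "complex^'n::{finite,linorder}"
    and u1 u2 u3 :: complex
  assumes "CARD('n) \<ge> 2" and "\<gamma> \<noteq> 0"
    and "u1 \<noteq> u2" and "u1 \<noteq> u3" and "u2 \<noteq> u3"
  shows
    "(nonres \<gamma> 0 lam \<longrightarrow>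
        leg12 (A_hat \<gamma> (u1 - u2) lam) ** leg13 (A_hat \<gamma> (u1 - u3) lam) ** leg23 (A_hat \<gamma> (u2 - u3) lam)
        = leg23 (A_hat \<gamma> (u2 - u3) lam) ** leg13 (A_hat \<gamma> (u1 - u3) lam) ** leg12 (A_hat \<gamma> (u1 - u2) lam))
   \<and> (nonres \<gamma> 1 lam \<longrightarrow>
        leg12 (A_hat \<gamma> (u1 - u2) lam) ** leg13 (C_hat \<gamma> lam) ** leg23 (C_hat \<gamma> lam)
        = leg23 (C_hat \<gamma> lam) ** leg13 (C_hat \<gamma> lam)
          ** dshift \<gamma> leg3 (\<lambda>\<mu>. leg12 (A_hat \<gamma> (u1 - u2) \<mu>)) lam)
   \<and> (nonres \<gamma> 2 lam \<longrightarrow>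
        leg12 (D_mat \<gamma> (u1 - u2) lam) ** leg13 (B_hat \<gamma> lam)
          ** dshift \<gamma> leg1 (\<lambda>\<mu>. leg23 (B_hat \<gamma> \<mu>)) lam
        = leg23 (B_hat \<gamma> lam) ** dshift \<gamma> leg2 (\<lambda>\<mu>. leg13 (B_hat \<gamma> \<mu>)) lam
          ** leg12 (D_mat \<gamma> (u1 - u2) lam))
   \<and> (nonres \<gamma> 1 lam \<longrightarrow>
        dshift \<gamma> leg3 (\<lambda>\<mu>. leg12 (D_mat \<gamma> (u1 - u2) \<mu>)) lam ** leg13 (D_mat \<gamma> (u1 - u3) lam)
          ** dshift \<gamma> leg1 (\<lambda>\<mu>. leg23 (D_mat \<gamma> (u2 - u3) \<mu>)) lam
        = leg23 (D_mat \<gamma> (u2 - u3) lam)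
          ** dshift \<gamma> leg2 (\<lambda>\<mu>. leg13 (D_mat \<gamma> (u1 - u3) \<mu>)) lam
          ** leg12 (D_mat \<gamma> (u1 - u2) lam))
   \<and> leg12 (R_hat \<gamma> (u1 - u2) :: 'n op2) ** leg13 (R_hat \<gamma> (u1 - u3)) ** leg23 (R_hat \<gamma> (u2 - u3))
        = leg23 (R_hat \<gamma> (u2 - u3)) ** leg13 (R_hat \<gamma> (u1 - u3)) ** leg12 (R_hat \<gamma> (u1 - u2))
   \<and> (nonres \<gamma> 0 lam \<longrightarrow> invertible (b_hat lam))
   \<and> (nonres \<gamma> 1 lam \<longrightarrow>
        B_hat \<gamma> lam
        = snd_leg (matrix_inv (b_hat lam)) ** dshift \<gamma> fst_leg (\<lambda>\<mu>. snd_leg (b_hat \<mu>)) lam)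
   \<and> (nonres \<gamma> 0 lam \<longrightarrow>
        A_hat \<gamma> (u1 - u2) lam
        = fst_leg (matrix_inv (b_hat lam)) ** snd_leg (matrix_inv (b_hat lam))
          ** R_hat \<gamma> (u1 - u2) ** fst_leg (b_hat lam) ** snd_leg (b_hat lam))
   \<and> (nonres \<gamma> 1 lam \<longrightarrow>
        D_mat \<gamma> (u1 - u2) lam
        = dshift \<gamma> snd_leg (\<lambda>\<mu>. fst_leg (matrix_inv (b_hat \<mu>))) lam
          ** snd_leg (matrix_inv (b_hat lam)) ** R_hat \<gamma> (u1 - u2)
          ** fst_leg (b_hat lam) ** dshift \<gamma> fst_leg (\<lambda>\<mu>. snd_leg (b_hat \<mu>)) lam)"
proof (intro conjI impI)
  \<comment> \<open>The lemmas use s = u1 - u2 and t = u2 - u3, so that s + t = u1 - u3.\<close>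
  have ne: "u1 - u2 \<noteq> 0" "u2 - u3 \<noteq> 0" "(u1 - u2) + (u2 - u3) \<noteq> 0"
    and eq: "(u1 - u2) + (u2 - u3) = u1 - u3"
    using assms by auto
  show "leg12 (A_hat \<gamma> (u1 - u2) lam) ** leg13 (A_hat \<gamma> (u1 - u3) lam) ** leg23 (A_hat \<gamma> (u2 - u3) lam)
      = leg23 (A_hat \<gamma> (u2 - u3) lam) ** leg13 (A_hat \<gamma> (u1 - u3) lam) ** leg12 (A_hat \<gamma> (u1 - u2) lam)"
    if "nonres \<gamma> 0 lam"
    using A_hat_yang_baxter[OF that ne] unfolding eq .
  show "leg12 (A_hat \<gamma> (u1 - u2) lam) ** leg13 (C_hat \<gamma> lam) ** leg23 (C_hat \<gamma> lam)
      = leg23 (C_hat \<gamma> lam) ** leg13 (C_hat \<gamma> lam)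
        ** dshift \<gamma> leg3 (\<lambda>\<mu>. leg12 (A_hat \<gamma> (u1 - u2) \<mu>)) lam" if "nonres \<gamma> 1 lam"
    using that by (rule A_hat_C_hat)
  show "leg12 (D_mat \<gamma> (u1 - u2) lam) ** leg13 (B_hat \<gamma> lam)
        ** dshift \<gamma> leg1 (\<lambda>\<mu>. leg23 (B_hat \<gamma> \<mu>)) lam
      = leg23 (B_hat \<gamma> lam) ** dshift \<gamma> leg2 (\<lambda>\<mu>. leg13 (B_hat \<gamma> \<mu>)) lam
        ** leg12 (D_mat \<gamma> (u1 - u2) lam)" if "nonres \<gamma> 2 lam"
    using that by (rule D_mat_B_hat)
  show "dshift \<gamma> leg3 (\<lambda>\<mu>. leg12 (D_mat \<gamma> (u1 - u2) \<mu>)) lam ** leg13 (D_mat \<gamma> (u1 - u3) lam)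
        ** dshift \<gamma> leg1 (\<lambda>\<mu>. leg23 (D_mat \<gamma> (u2 - u3) \<mu>)) lam
      = leg23 (D_mat \<gamma> (u2 - u3) lam)
        ** dshift \<gamma> leg2 (\<lambda>\<mu>. leg13 (D_mat \<gamma> (u1 - u3) \<mu>)) lam
        ** leg12 (D_mat \<gamma> (u1 - u2) lam)" if "nonres \<gamma> 1 lam"
    using D_mat_dynamical_yang_baxter[OF that ne] unfolding eq .
  show "leg12 (R_hat \<gamma> (u1 - u2) :: 'n op2) ** leg13 (R_hat \<gamma> (u1 - u3)) ** leg23 (R_hat \<gamma> (u2 - u3))
      = leg23 (R_hat \<gamma> (u2 - u3)) ** leg13 (R_hat \<gamma> (u1 - u3)) ** leg12 (R_hat \<gamma> (u1 - u2))"
    using R_hat_yang_baxter[OF ne] unfolding eq .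
  show "invertible (b_hat lam)" if "nonres \<gamma> 0 lam"
    unfolding invertible_def using vandermonde_b_hat[OF that] by blast
  show "B_hat \<gamma> lam
      = snd_leg (matrix_inv (b_hat lam)) ** dshift \<gamma> fst_leg (\<lambda>\<mu>. snd_leg (b_hat \<mu>)) lam"
    if "nonres \<gamma> 1 lam"
    unfolding matrix_inv_b_hat[OF nonres_mono[OF that zero_le]] by (rule B_hat_eq[OF that])
  show "A_hat \<gamma> (u1 - u2) lam
      = fst_leg (matrix_inv (b_hat lam)) ** snd_leg (matrix_inv (b_hat lam))
        ** R_hat \<gamma> (u1 - u2) ** fst_leg (b_hat lam) ** snd_leg (b_hat lam)" if "nonres \<gamma> 0 lam"
    by (simp add: A_hat_conj[OF that] matrix_inv_b_hat[OF that] tensor_mult)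
       (simp add: matrix_mul_assoc[symmetric] tensor_mult)
  show "D_mat \<gamma> (u1 - u2) lam
      = dshift \<gamma> snd_leg (\<lambda>\<mu>. fst_leg (matrix_inv (b_hat \<mu>))) lam
        ** snd_leg (matrix_inv (b_hat lam)) ** R_hat \<gamma> (u1 - u2)
        ** fst_leg (b_hat lam) ** dshift \<gamma> fst_leg (\<lambda>\<mu>. snd_leg (b_hat \<mu>)) lam" if "nonres \<gamma> 1 lam"
    using that \<open>\<gamma> \<noteq> 0\<close> by (rule D_mat_eq)
qed

end
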